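(* Let $n$ be odd. If the sequence $\left(\dim H_1(B_n[m];\mathbb{Q})\right)_{m=1}^\infty$ is unbounded, then $H_1(\mathcal{BI}_n;\mathbb{Q})$ is infinite dimensional, and in particular $\mathcal{BI}_n$ is not finitely generated.
   Context: $B_n$ is the braid group on $n$ strands. The integral Burau representation of $B_n$ is the composition $B_n\to GL_n(\mathbb{Z}[t,t^{-1}])\to GL_n(\mathbb{Z})$ of the unreduced Burau representation with evaluation at $t=-1$. For an integer $m\ge1$, the level $m$ braid group $B_n[m]$ is the kernel of the reduction of the integral Burau representation mod $m$; it is a finite-index subgroup of $B_n$. The braid Torelli group $\mathcal{BI}_n$ is the kernel of the integral Burau representation.
   Formalization: The case n = 3 is excluded, since the claim fails there: BI_3 is infinite cyclic, generated by Δ^4, while B_3[m] surjects onto Γ(m), free of unbounded rank for m ≥ 3, so the dimensions are unbounded. *)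

theory Defs
  imports
    "HOL-Algebra.Algebra"
    "HOL-Library.Poly_Mapping"
    "Jordan_Normal_Form.VS_Connect"
begin

section \<open>The braid group\<close>

text \<open>The strands are numbered from \<open>0\<close>, so that the Artin generators of the braid group on
  \<open>n\<close> strands are \<open>\<sigma>\<^sub>i\<close> with \<open>Suc i < n\<close>. The letter \<open>(i, True)\<close> stands for \<open>\<sigma>\<^sub>i\<close> and
  \<open>(i, False)\<close> for its inverse.\<close>

type_synonym braid_word = "(nat \<times> bool) list"

definition braid_words :: "nat \<Rightarrow> braid_word set" where
  "braid_words n = lists ({i. Suc i < n} \<times> UNIV)"

inductive_set braid_eq :: "nat \<Rightarrow> (braid_word \<times> braid_word) set" for n where
  eq_refl: "u \<in> braid_words n \<Longrightarrow> (u, u) \<in> braid_eq n"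
| eq_sym: "(u, v) \<in> braid_eq n \<Longrightarrow> (v, u) \<in> braid_eq n"
| eq_trans: "(u, v) \<in> braid_eq n \<Longrightarrow> (v, w) \<in> braid_eq n \<Longrightarrow> (u, w) \<in> braid_eq n"
| cancel: "u \<in> braid_words n \<Longrightarrow> v \<in> braid_words n \<Longrightarrow> Suc i < n \<Longrightarrow>
    (u @ [(i, b), (i, \<not> b)] @ v, u @ v) \<in> braid_eq n"
| far: "u \<in> braid_words n \<Longrightarrow> v \<in> braid_words n \<Longrightarrow> Suc i < j \<Longrightarrow> Suc j < n \<Longrightarrow>
    (u @ [(i, True), (j, True)] @ v, u @ [(j, True), (i, True)] @ v) \<in> braid_eq n"
| braid: "u \<in> braid_words n \<Longrightarrow> v \<in> braid_words n \<Longrightarrow> Suc (Suc i) < n \<Longrightarrow>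
    (u @ [(i, True), (Suc i, True), (i, True)] @ v,
     u @ [(Suc i, True), (i, True), (Suc i, True)] @ v) \<in> braid_eq n"

definition braid_group :: "nat \<Rightarrow> braid_word set monoid" where
  "braid_group n =
    \<lparr>carrier = braid_words n // braid_eq n,
     monoid.mult = (\<lambda>x y. \<Union>u\<in>x. \<Union>v\<in>y. braid_eq n `` {u @ v}),
     one = braid_eq n `` {[]}\<rparr>"


section \<open>The Burau representation\<close>

text \<open>Laurent polynomials over the integers are the group algebra of the additive group of
  exponents.\<close>

type_synonym laurent = "int \<Rightarrow>\<^sub>0 int"

abbreviation lmonom :: "int \<Rightarrow> laurent" where
  "lmonom k \<equiv> Poly_Mapping.single k 1"

definition GL :: "'a::semiring_1 itself \<Rightarrow> nat \<Rightarrow> 'a mat monoid" where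
  "GL ty n = units_of (ring_mat ty n ())"

text \<open>\<open>\<sigma>\<^sub>i\<close> acts as the block with rows \<open>(1 - t, t)\<close> and \<open>(1, 0)\<close> in the rows and columns
  \<open>i\<close>, \<open>i + 1\<close>, its inverse as the inverse block with rows \<open>(0, 1)\<close> and
  \<open>(t\<^sup>-\<^sup>1, 1 - t\<^sup>-\<^sup>1)\<close>.\<close>

definition burau_gen :: "nat \<Rightarrow> nat \<times> bool \<Rightarrow> laurent mat" where
  "burau_gen n = (\<lambda>(i, b). mat n n (\<lambda>(r, c).
     if (r, c) = (i, i) then (if b then 1 - lmonom 1 else 0)
     else if (r, c) = (i, Suc i) then (if b then lmonom 1 else 1)
     else if (r, c) = (Suc i, i) then (if b then 1 else lmonom (-1))
     else if (r, c) = (Suc i, Suc i) then (if b then 0 else 1 - lmonom (-1))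
     else if r = c then 1 else 0))"

definition burau_word :: "nat \<Rightarrow> braid_word \<Rightarrow> laurent mat" where
  "burau_word n w = foldr (\<lambda>g M. burau_gen n g * M) w (1\<^sub>m n)"

text \<open>Equivalent words have the same matrix (shown below), so the image of a class is a
  singleton.\<close>

definition burau :: "nat \<Rightarrow> braid_word set \<Rightarrow> laurent mat" where
  "burau n x = the_elem (burau_word n ` x)"

text \<open>The substitution \<open>t := -1\<close>; since \<open>-1\<close> is its own inverse, \<open>t\<^sup>k\<close> goes to
  \<open>(-1)\<^sup>|\<^sup>k\<^sup>|\<close>.\<close>

definition eval_minus_one :: "laurent \<Rightarrow> int" where
  "eval_minus_one p = (\<Sum>k\<in>Poly_Mapping.keys p. Poly_Mapping.lookup p k * (-1) ^ nat \<bar>k\<bar>)"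

definition integral_burau :: "nat \<Rightarrow> braid_word set \<Rightarrow> int mat" where
  "integral_burau n x = map_mat eval_minus_one (burau n x)"

definition level_braid :: "nat \<Rightarrow> nat \<Rightarrow> braid_word set set" where
  "level_braid n m = {x \<in> carrier (braid_group n).
     map_mat (\<lambda>a. a mod int m) (integral_burau n x) = map_mat (\<lambda>a. a mod int m) (1\<^sub>m n)}"

definition braid_torelli :: "nat \<Rightarrow> braid_word set set" where
  "braid_torelli n = kernel (braid_group n) (GL TYPE(int) n) (integral_burau n)"

abbreviation level_braid_group :: "nat \<Rightarrow> nat \<Rightarrow> braid_word set monoid" where
  "level_braid_group n m \<equiv> (braid_group n)\<lparr>carrier := level_braid n m\<rparr>"

abbreviation braid_torelli_group :: "nat \<Rightarrow> braid_word set monoid" where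
  "braid_torelli_group n \<equiv> (braid_group n)\<lparr>carrier := braid_torelli n\<rparr>"

definition finitely_generated :: "('a, 'b) monoid_scheme \<Rightarrow> bool" where
  "finitely_generated G \<longleftrightarrow> (\<exists>S. finite S \<and> S \<subseteq> carrier G \<and> generate G S = carrier G)"


section \<open>First rational homology of a group\<close>

text \<open>We use the (inhomogeneous) bar complex with trivial rational coefficients. Its 1-chains
  and 2-chains are the rational vector spaces with bases the elements, and the pairs of
  elements, of the group. The boundary of \<open>[g|h]\<close> is \<open>[h] - [gh] + [g]\<close>, and the
  boundary of every 1-chain vanishes, so that all 1-chains are cycles.\<close>

definition chains1 :: "('a, 'b) monoid_scheme \<Rightarrow> ('a \<Rightarrow>\<^sub>0 rat) set" where
  "chains1 G = {c. Poly_Mapping.keys c \<subseteq> carrier G}"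

definition chains2 :: "('a, 'b) monoid_scheme \<Rightarrow> ('a \<times> 'a \<Rightarrow>\<^sub>0 rat) set" where
  "chains2 G = {c. Poly_Mapping.keys c \<subseteq> carrier G \<times> carrier G}"

definition boundary2 :: "('a, 'b) monoid_scheme \<Rightarrow> ('a \<times> 'a \<Rightarrow>\<^sub>0 rat) \<Rightarrow> ('a \<Rightarrow>\<^sub>0 rat)" where
  "boundary2 G c = (\<Sum>(g, h)\<in>Poly_Mapping.keys c. let q = Poly_Mapping.lookup c (g, h) in
     Poly_Mapping.single h q - Poly_Mapping.single (g \<otimes>\<^bsub>G\<^esub> h) q + Poly_Mapping.single g q)"

definition boundaries1 :: "('a, 'b) monoid_scheme \<Rightarrow> ('a \<Rightarrow>\<^sub>0 rat) set" where
  "boundaries1 G = boundary2 G ` chains2 G"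

definition H1_class :: "('a, 'b) monoid_scheme \<Rightarrow> ('a \<Rightarrow>\<^sub>0 rat) \<Rightarrow> ('a \<Rightarrow>\<^sub>0 rat) set" where
  "H1_class G c = {c + b |b. b \<in> boundaries1 G}"

text \<open>The quotient vector space over \<^term>\<open>class_ring :: rat ring\<close>. The multiplicative fields
  of the record play no role for a module.\<close>

definition H1 :: "('a, 'b) monoid_scheme \<Rightarrow> (rat, ('a \<Rightarrow>\<^sub>0 rat) set) module" where
  "H1 G =
    \<lparr>carrier = H1_class G ` chains1 G,
     monoid.mult = undefined,
     one = undefined,
     ring.zero = H1_class G 0,
     ring.add = (\<lambda>A B. \<Union>x\<in>A. \<Union>y\<in>B. H1_class G (x + y)),
     module.smult = (\<lambda>q A. \<Union>x\<in>A. H1_class G (Poly_Mapping.map ((*) q) x))\<rparr>"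

abbreviation H1_fin_dim :: "('a, 'b) monoid_scheme \<Rightarrow> bool" where
  "H1_fin_dim G \<equiv> vectorspace.fin_dim (class_ring :: rat ring) (H1 G)"

text \<open>On a space that is not finite-dimensional \<^term>\<open>vectorspace.dim\<close> is unspecified. The level
  groups have finite index in the (finitely generated) braid group, so their first homology is
  finite-dimensional and this does not matter there.

  For \<open>n = 3\<close> the integral Burau representation is, up to a trivial summand, the surjection
  onto \<open>SL\<^sub>2(\<int>)\<close>. Its kernel is the infinite cyclic group generated by \<open>\<Delta>\<^sup>4\<close>, whereas
  the level \<open>m\<close> groups map onto the principal congruence subgroups \<open>\<Gamma>(m)\<close>, which for
  \<open>m \<ge> 3\<close> are free of unbounded rank. A statement deducing that the first homology of
  the braid Torelli group is infinite-dimensional from the growth of these dimensions therefore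
  has to exclude three strands.\<close>

abbreviation H1_dim :: "('a, 'b) monoid_scheme \<Rightarrow> nat" where
  "H1_dim G \<equiv> vectorspace.dim (class_ring :: rat ring) (H1 G)"


section \<open>Well-definedness\<close>

lemma braid_words_append [simp]: "u @ v \<in> braid_words n \<longleftrightarrow> u \<in> braid_words n \<and> v \<in> braid_words n"
  by (auto simp: braid_words_def)

lemma braid_words_Nil [simp]: "[] \<in> braid_words n"
  by (auto simp: braid_words_def)

lemma braid_words_Cons [simp]:
  "(i, b) # v \<in> braid_words n \<longleftrightarrow> Suc i < n \<and> v \<in> braid_words n"
  by (auto simp: braid_words_def)

lemma braid_eq_words: "(u, v) \<in> braid_eq n \<Longrightarrow> u \<in> braid_words n \<and> v \<in> braid_words n"
  by (induction rule: braid_eq.induct) auto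

lemma equiv_braid_eq: "equiv (braid_words n) (braid_eq n)"
proof (rule equivI)
  show "braid_eq n \<subseteq> braid_words n \<times> braid_words n" using braid_eq_words by auto
qed (auto intro: refl_onI symI transI braid_eq.eq_refl braid_eq.eq_sym dest: braid_eq.eq_trans)

lemma braid_eq_context:
  assumes "(u, v) \<in> braid_eq n" "a \<in> braid_words n" "b \<in> braid_words n"
  shows "(a @ u @ b, a @ v @ b) \<in> braid_eq n"
  using assms
proof (induction rule: braid_eq.induct)
  case (eq_trans u v w)
  then show ?case by (blast intro: braid_eq.eq_trans)
next
  case (cancel u v i c)
  then show ?case using braid_eq.cancel[of "a @ u" n "v @ b" i c] by simp
next
  case (far u v i j)
  then show ?case using braid_eq.far[of "a @ u" n "v @ b" i j] by simp
next
  case (braid u v i)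
  then show ?case using braid_eq.braid[of "a @ u" n "v @ b" i] by simp
qed (auto intro: braid_eq.eq_refl braid_eq.eq_sym)

lemma congruent2_append:
  "congruent2 (braid_eq n) (braid_eq n) (\<lambda>u v. braid_eq n `` {u @ v})"
proof (rule congruent2I'; rule equiv_class_eq[OF equiv_braid_eq])
  fix u u' v v' assume uv: "(u, u') \<in> braid_eq n" "(v, v') \<in> braid_eq n"
  then have "(u @ v, u' @ v) \<in> braid_eq n"
    using braid_eq_context[of u u' n "[]" v] braid_eq_words by fastforce
  moreover have "(u' @ v, u' @ v') \<in> braid_eq n"
    using uv braid_eq_context[of v v' n "u'" "[]"] braid_eq_words by fastforce
  ultimately show "(u @ v, u' @ v') \<in> braid_eq n" by (rule braid_eq.eq_trans)
qed

lemma braid_group_mult: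
  assumes "u \<in> braid_words n" "v \<in> braid_words n"
  shows "braid_eq n `` {u} \<otimes>\<^bsub>braid_group n\<^esub> braid_eq n `` {v} = braid_eq n `` {u @ v}"
  using UN_equiv_class2[OF equiv_braid_eq equiv_braid_eq congruent2_append assms]
  by (simp add: braid_group_def)

lemma braid_group_carrierE:
  assumes "x \<in> carrier (braid_group n)"
  obtains u where "u \<in> braid_words n" "x = braid_eq n `` {u}"
  using assms by (auto simp: braid_group_def quotient_def)

lemma braid_group_carrierI: "u \<in> braid_words n \<Longrightarrow> braid_eq n `` {u} \<in> carrier (braid_group n)"
  by (auto simp: braid_group_def quotient_def)

lemma braid_word_inverse:
  "u \<in> braid_words n \<Longrightarrow> \<exists>v\<in>braid_words n. (v @ u, []) \<in> braid_eq n"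
proof (induction u)
  case Nil
  show ?case by (rule bexI[of _ "[]"]) (auto intro: braid_eq.eq_refl)
next
  case (Cons g u)
  obtain i b where g: "g = (i, b)" by (cases g)
  from Cons g obtain v where v: "v \<in> braid_words n" "(v @ u, []) \<in> braid_eq n" by auto
  have "((v @ [(i, \<not> b)]) @ (i, b) # u, v @ u) \<in> braid_eq n"
    using braid_eq.cancel[of v n u i "\<not> b"] v Cons.prems g by auto
  with v have "((v @ [(i, \<not> b)]) @ (i, b) # u, []) \<in> braid_eq n" by (blast intro: braid_eq.eq_trans)
  moreover have "v @ [(i, \<not> b)] \<in> braid_words n" using v Cons.prems g by auto
  ultimately show ?case using g by blast
qed

lemma group_braid_group: "group (braid_group n)"
proof (rule groupI)
  have one: "\<one>\<^bsub>braid_group n\<^esub> = braid_eq n `` {[]}" by (simp add: braid_group_def)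
  show "\<one>\<^bsub>braid_group n\<^esub> \<in> carrier (braid_group n)"
    unfolding one by (simp add: braid_group_carrierI)
  fix x assume x: "x \<in> carrier (braid_group n)"
  then obtain u where u: "u \<in> braid_words n" "x = braid_eq n `` {u}" by (rule braid_group_carrierE)
  show "\<one>\<^bsub>braid_group n\<^esub> \<otimes>\<^bsub>braid_group n\<^esub> x = x"
    unfolding one using u by (simp add: braid_group_mult)
  obtain v where v: "v \<in> braid_words n" "(v @ u, []) \<in> braid_eq n"
    using braid_word_inverse u by blast
  then have "braid_eq n `` {v} \<otimes>\<^bsub>braid_group n\<^esub> x = \<one>\<^bsub>braid_group n\<^esub>"
    unfolding one using u by (simp add: braid_group_mult equiv_class_eq[OF equiv_braid_eq])
  with v show "\<exists>y\<in>carrier (braid_group n). y \<otimes>\<^bsub>braid_group n\<^esub> x = \<one>\<^bsub>braid_group n\<^esub>"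
    using braid_group_carrierI by blast
  fix y assume y: "y \<in> carrier (braid_group n)"
  then obtain v where v: "v \<in> braid_words n" "y = braid_eq n `` {v}" by (rule braid_group_carrierE)
  show "x \<otimes>\<^bsub>braid_group n\<^esub> y \<in> carrier (braid_group n)"
    using u v by (simp add: braid_group_mult braid_group_carrierI)
  fix z assume "z \<in> carrier (braid_group n)"
  then obtain w where "w \<in> braid_words n" "z = braid_eq n `` {w}" by (rule braid_group_carrierE)
  then show "x \<otimes>\<^bsub>braid_group n\<^esub> y \<otimes>\<^bsub>braid_group n\<^esub> z = x \<otimes>\<^bsub>braid_group n\<^esub> (y \<otimes>\<^bsub>braid_group n\<^esub> z)"
    using u v by (simp add: braid_group_mult)
qed

lemma lmonom_mult: "lmonom a * lmonom b = lmonom (a + b)"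
  by (simp add: Poly_Mapping.mult_single)

lemma lmonom_inverse [simp]: "lmonom 1 * lmonom (-1) = 1" "lmonom (-1) * lmonom 1 = 1"
  by (simp_all add: lmonom_mult)

lemma burau_gen_carrier [simp]: "burau_gen n g \<in> carrier_mat n n"
  by (cases g) (simp add: burau_gen_def)

lemma burau_word_carrier [simp]: "burau_word n w \<in> carrier_mat n n"
  by (induction w) (auto simp: burau_word_def intro!: mult_carrier_mat[of _ n n])

lemma burau_word_simps [simp]:
  "burau_word n [] = 1\<^sub>m n"
  "burau_word n (g # w) = burau_gen n g * burau_word n w"
  by (simp_all add: burau_word_def)

lemma burau_word_append: "burau_word n (u @ v) = burau_word n u * burau_word n v"
proof (induction u)
  case Nil
  then show ?case using left_mult_one_mat[OF burau_word_carrier] by simp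
next
  case (Cons g u)
  then show ?case
    using assoc_mult_mat[OF burau_gen_carrier burau_word_carrier burau_word_carrier] by simp
qed

text \<open>Rows of a product with a generator, used to check the braid relations entrywise.\<close>

lemma burau_gen_mult:
  assumes A: "A \<in> carrier_mat n n" and i: "Suc i < n"
  shows "burau_gen n (i, b) * A = mat n n (\<lambda>(r, c).
     if r = i then (if b then (1 - lmonom 1) * A $$ (i, c) + lmonom 1 * A $$ (Suc i, c)
       else A $$ (Suc i, c))
     else if r = Suc i then (if b then A $$ (i, c)
       else lmonom (-1) * A $$ (i, c) + (1 - lmonom (-1)) * A $$ (Suc i, c))
     else A $$ (r, c))" (is "_ = ?R")
proof (rule eq_matI)
  show "dim_row (burau_gen n (i, b) * A) = dim_row ?R" "dim_col (burau_gen n (i, b) * A) = dim_col ?R"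
    using A by (auto simp: burau_gen_def)
  fix r c assume "r < dim_row ?R" "c < dim_col ?R"
  then have rc: "r < n" "c < n" by auto
  let ?B = "burau_gen n (i, b)"
  have *: "(?B * A) $$ (r, c) = (\<Sum>k<n. ?B $$ (r, k) * A $$ (k, c))"
    using A rc carrier_matD[OF burau_gen_carrier[of n "(i, b)"]]
    by (auto simp: scalar_prod_def lessThan_atLeast0 intro!: sum.cong)
  have B: "?B $$ (q, k) = (if (q, k) = (i, i) then (if b then 1 - lmonom 1 else 0)
     else if (q, k) = (i, Suc i) then (if b then lmonom 1 else 1)
     else if (q, k) = (Suc i, i) then (if b then 1 else lmonom (-1))
     else if (q, k) = (Suc i, Suc i) then (if b then 0 else 1 - lmonom (-1))
     else if q = k then 1 else 0)" if "q < n" "k < n" for q k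
    using that by (simp add: burau_gen_def)
  show "(?B * A) $$ (r, c) = ?R $$ (r, c)"
  proof (cases "r = i \<or> r = Suc i")
    case True
    have "(\<Sum>k<n. ?B $$ (r, k) * A $$ (k, c)) = (\<Sum>k\<in>{i, Suc i}. ?B $$ (r, k) * A $$ (k, c))"
    proof (intro sum.mono_neutral_right ballI)
      fix k assume k: "k \<in> {..<n} - {i, Suc i}"
      then have "?B $$ (r, k) = 0" using B[OF rc(1), of k] True by auto
      then show "?B $$ (r, k) * A $$ (k, c) = 0" by simp
    qed (use i in auto)
    then have 1: "(?B * A) $$ (r, c) = ?B $$ (r, i) * A $$ (i, c) + ?B $$ (r, Suc i) * A $$ (Suc i, c)"
      unfolding * by simp
    show ?thesis
    proof (cases "r = i")
      case True
      with i have "?B $$ (r, i) = (if b then 1 - lmonom 1 else 0)"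
        "?B $$ (r, Suc i) = (if b then lmonom 1 else 1)"
        using B[of i i] B[of i "Suc i"] by auto
      with 1 True rc show ?thesis by (simp del: index_mult_mat)
    next
      case False
      with \<open>r = i \<or> r = Suc i\<close> i have "?B $$ (r, i) = (if b then 1 else lmonom (-1))"
        "?B $$ (r, Suc i) = (if b then 0 else 1 - lmonom (-1))"
        using B[of "Suc i" i] B[of "Suc i" "Suc i"] by auto
      with 1 False \<open>r = i \<or> r = Suc i\<close> rc show ?thesis by (simp del: index_mult_mat)
    qed
  next
    case False
    have "(\<Sum>k<n. ?B $$ (r, k) * A $$ (k, c)) = (\<Sum>k\<in>{r}. ?B $$ (r, k) * A $$ (k, c))"
    proof (intro sum.mono_neutral_right ballI)
      fix k assume k: "k \<in> {..<n} - {r}"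
      then have "?B $$ (r, k) = 0" using B[OF rc(1), of k] False by auto
      then show "?B $$ (r, k) * A $$ (k, c) = 0" by simp
    qed (use rc in auto)
    then have 1: "(?B * A) $$ (r, c) = ?B $$ (r, r) * A $$ (r, c)" unfolding * by simp
    have "?B $$ (r, r) = 1" using B[OF rc(1) rc(1)] False by auto
    with 1 False rc show ?thesis by (simp del: index_mult_mat)
  qed
qed

lemma burau_gen_cancel:
  assumes A: "A \<in> carrier_mat n n" and i: "Suc i < n"
  shows "burau_gen n (i, b) * (burau_gen n (i, \<not> b) * A) = A"
proof -
  have t: "lmonom 1 * (lmonom (-1) * x) = x" "lmonom (-1) * (lmonom 1 * x) = x" for x
    by (simp_all flip: mult.assoc)
  show ?thesis
    by (subst burau_gen_mult[OF A i], subst burau_gen_mult[OF _ i], simp)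
      (use A i in \<open>auto intro!: eq_matI simp: algebra_simps t\<close>)
qed

lemma burau_gen_far:
  assumes A: "A \<in> carrier_mat n n" and ij: "Suc i < j" "Suc j < n"
  shows "burau_gen n (i, True) * (burau_gen n (j, True) * A)
       = burau_gen n (j, True) * (burau_gen n (i, True) * A)"
  using ij by (subst (1 2 3 4) burau_gen_mult) (auto intro!: eq_matI simp: A)

lemma burau_gen_braid:
  assumes A: "A \<in> carrier_mat n n" and i: "Suc (Suc i) < n"
  shows "burau_gen n (i, True) * (burau_gen n (Suc i, True) * (burau_gen n (i, True) * A))
       = burau_gen n (Suc i, True) * (burau_gen n (i, True) * (burau_gen n (Suc i, True) * A))"
  using i by (subst (1 2 3 4 5 6) burau_gen_mult) (auto intro!: eq_matI simp: A algebra_simps)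

lemma burau_word_cong: "(u, v) \<in> braid_eq n \<Longrightarrow> burau_word n u = burau_word n v"
proof (induction rule: braid_eq.induct)
  case (cancel u v i b)
  show ?case
    using burau_gen_cancel[OF burau_word_carrier[of n v] cancel(3), of b]
    by (simp add: burau_word_append)
next
  case (far u v i j)
  show ?case
    using burau_gen_far[OF burau_word_carrier[of n v] far(3,4)]
    by (simp only: burau_word_append burau_word_simps append_Cons append_Nil)
next
  case (braid u v i)
  show ?case
    using burau_gen_braid[OF burau_word_carrier[of n v] braid(3)]
    by (simp only: burau_word_append burau_word_simps append_Cons append_Nil)
qed auto

lemma burau_class: "u \<in> braid_words n \<Longrightarrow> burau n (braid_eq n `` {u}) = burau_word n u"
proof -
  assume u: "u \<in> braid_words n"
  have "burau_word n ` (braid_eq n `` {u}) = {burau_word n u}"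
  proof (intro equalityI subsetI)
    fix M assume "M \<in> burau_word n ` (braid_eq n `` {u})"
    then show "M \<in> {burau_word n u}" using burau_word_cong by fastforce
  qed (use braid_eq.eq_refl[OF u] in blast)
  then show ?thesis by (simp add: burau_def)
qed

lemma burau_word_unit:
  assumes "u \<in> braid_words n"
  shows "burau_word n u \<in> carrier (GL TYPE(laurent) n)"
proof -
  obtain v where v: "v \<in> braid_words n" "(v @ u, []) \<in> braid_eq n"
    using braid_word_inverse assms by blast
  obtain w where w: "w \<in> braid_words n" "(w @ v, []) \<in> braid_eq n"
    using braid_word_inverse v by blast
  have "burau_word n v * burau_word n u = 1\<^sub>m n"
    using burau_word_cong[OF v(2)] by (simp add: burau_word_append)
  moreover have "burau_word n w * burau_word n v = 1\<^sub>m n"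
    using burau_word_cong[OF w(2)] by (simp add: burau_word_append)
  then have "burau_word n w = burau_word n u"
    using calculation assoc_mult_mat[OF burau_word_carrier burau_word_carrier burau_word_carrier, of n w v u]
    by (simp add: left_mult_one_mat[OF burau_word_carrier] right_mult_one_mat[OF burau_word_carrier])
  ultimately show ?thesis
    using \<open>burau_word n w * burau_word n v = 1\<^sub>m n\<close>
    by (auto simp: GL_def units_of_def Units_def ring_mat_simps intro!: bexI[of _ "burau_word n v"])
qed

lemma burau_hom: "burau n \<in> hom (braid_group n) (GL TYPE(laurent) n)"
proof (rule homI)
  fix x assume "x \<in> carrier (braid_group n)"
  then obtain u where u: "u \<in> braid_words n" "x = braid_eq n `` {u}" by (rule braid_group_carrierE)
  then show "burau n x \<in> carrier (GL TYPE(laurent) n)" by (simp add: burau_class burau_word_unit)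
  fix y assume "y \<in> carrier (braid_group n)"
  then obtain v where "v \<in> braid_words n" "y = braid_eq n `` {v}" by (rule braid_group_carrierE)
  with u show "burau n (x \<otimes>\<^bsub>braid_group n\<^esub> y) = burau n x \<otimes>\<^bsub>GL TYPE(laurent) n\<^esub> burau n y"
    by (simp add: braid_group_mult burau_class burau_word_append GL_def units_of_def ring_mat_simps)
qed

lemma eval_minus_one_superset:
  assumes "finite K" "Poly_Mapping.keys p \<subseteq> K"
  shows "eval_minus_one p = (\<Sum>k\<in>K. Poly_Mapping.lookup p k * (-1) ^ nat \<bar>k\<bar>)"
  unfolding eval_minus_one_def using assms
  by (intro sum.mono_neutral_left) (auto simp: in_keys_iff)

lemma eval_minus_one_add: "eval_minus_one (p + q) = eval_minus_one p + eval_minus_one q"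
proof -
  let ?K = "Poly_Mapping.keys p \<union> Poly_Mapping.keys q"
  have "Poly_Mapping.keys (p + q) \<subseteq> ?K" by (rule Poly_Mapping.keys_add)
  then show ?thesis
    by (simp add: eval_minus_one_superset[of ?K] Poly_Mapping.lookup_add algebra_simps sum.distrib)
qed

lemma eval_minus_one_single: "eval_minus_one (Poly_Mapping.single k a) = a * (-1) ^ nat \<bar>k\<bar>"
  by (simp add: eval_minus_one_superset[of "{k}"])

lemma poly_mapping_sum_single_lookup:
  "(\<Sum>k\<in>Poly_Mapping.keys p. Poly_Mapping.single k (Poly_Mapping.lookup p k)) = p"
  by (rule poly_mapping_eqI) (simp add: lookup_sum lookup_single when_def in_keys_iff)

lemma poly_mapping_single_induct [case_names zero add]:
  fixes p :: "'a \<Rightarrow>\<^sub>0 'b::comm_monoid_add"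
  assumes "P 0" and "\<And>k a p. P p \<Longrightarrow> P (Poly_Mapping.single k a + p)"
  shows "P p"
proof -
  have "P (\<Sum>k\<in>K. Poly_Mapping.single k (Poly_Mapping.lookup p k))" if "finite K" for K
    using that by (induction K) (auto intro: assms)
  from this[of "Poly_Mapping.keys p"] show ?thesis
    by (simp only: poly_mapping_sum_single_lookup finite_keys)
qed

lemma minus_one_power_abs_add: "(-1::int) ^ nat \<bar>k + l\<bar> = (-1) ^ nat \<bar>k\<bar> * (-1) ^ nat \<bar>l\<bar>"
  by (simp add: minus_one_power_iff even_nat_iff)

lemma eval_minus_one_mult_single:
  "eval_minus_one (Poly_Mapping.single k a * q) = a * (-1) ^ nat \<bar>k\<bar> * eval_minus_one q"
  by (induction q rule: poly_mapping_single_induct)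
    (simp_all add: distrib_left eval_minus_one_add Poly_Mapping.mult_single eval_minus_one_single
      minus_one_power_abs_add, simp add: eval_minus_one_def)

lemma eval_minus_one_mult: "eval_minus_one (p * q) = eval_minus_one p * eval_minus_one q"
  by (induction p rule: poly_mapping_single_induct)
    (simp_all add: distrib_right eval_minus_one_add eval_minus_one_mult_single eval_minus_one_single,
      simp add: eval_minus_one_def)

interpretation eval_minus_one: ring_hom eval_minus_one
  by unfold_locales
    (simp_all add: eval_minus_one_add eval_minus_one_mult, simp_all add: eval_minus_one_def)

lemma map_mat_eval_hom: "map_mat eval_minus_one \<in> hom (GL TYPE(laurent) n) (GL TYPE(int) n)"
proof (rule homI)
  fix A assume "A \<in> carrier (GL TYPE(laurent) n)"
  then obtain B where B: "A \<in> carrier_mat n n" "B \<in> carrier_mat n n" "B * A = 1\<^sub>m n" "A * B = 1\<^sub>m n"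
    by (auto simp: GL_def units_of_def Units_def ring_mat_simps)
  then show "map_mat eval_minus_one A \<in> carrier (GL TYPE(int) n)"
    using eval_minus_one.mat_hom_mult[OF B(1,2)] eval_minus_one.mat_hom_mult[OF B(2,1)]
      eval_minus_one.mat_hom_one[of n]
    by (auto simp: GL_def units_of_def Units_def ring_mat_simps intro!: bexI[of _ "map_mat eval_minus_one B"])
  fix A' assume "A' \<in> carrier (GL TYPE(laurent) n)"
  with B show "map_mat eval_minus_one (A \<otimes>\<^bsub>GL TYPE(laurent) n\<^esub> A')
      = map_mat eval_minus_one A \<otimes>\<^bsub>GL TYPE(int) n\<^esub> map_mat eval_minus_one A'"
    by (auto simp: GL_def units_of_def Units_def ring_mat_simps eval_minus_one.mat_hom_mult[of _ n n _ n])
qed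

lemma integral_burau_hom: "integral_burau n \<in> hom (braid_group n) (GL TYPE(int) n)"
  using Group.hom_compose[OF burau_hom map_mat_eval_hom]
  by (simp add: integral_burau_def [abs_def] comp_def)

lemma group_GL: "group (GL TYPE('a::ring_1) n)"
  unfolding GL_def
  by (rule monoid.units_group, rule semiring.axioms(2), rule semiring_mat)

lemma subgroup_braid_torelli: "subgroup (braid_torelli n) (braid_group n)"
  unfolding braid_torelli_def
  by (intro group_hom.subgroup_kernel group_hom.intro group_hom_axioms.intro
    group_braid_group group_GL integral_burau_hom)

lemma mod_mat_mult:
  fixes A B :: "int mat"
  assumes "A \<in> carrier_mat n n" "A' \<in> carrier_mat n n" "B \<in> carrier_mat n n" "B' \<in> carrier_mat n n"
    and "map_mat (\<lambda>a. a mod k) A = map_mat (\<lambda>a. a mod k) A'"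
    and "map_mat (\<lambda>a. a mod k) B = map_mat (\<lambda>a. a mod k) B'"
  shows "map_mat (\<lambda>a. a mod k) (A * B) = map_mat (\<lambda>a. a mod k) (A' * B')"
proof (rule eq_matI)
  fix r c assume "r < dim_row (map_mat (\<lambda>a. a mod k) (A' * B'))"
    "c < dim_col (map_mat (\<lambda>a. a mod k) (A' * B'))"
  then have rc: "r < n" "c < n" using assms(2,4) by auto
  have A: "A $$ (r, l) mod k = A' $$ (r, l) mod k" if "l < n" for l
    using arg_cong[OF assms(5), of "\<lambda>M. M $$ (r, l)"] rc that assms(1,2) by auto
  have B: "B $$ (l, c) mod k = B' $$ (l, c) mod k" if "l < n" for l
    using arg_cong[OF assms(6), of "\<lambda>M. M $$ (l, c)"] rc that assms(3,4) by auto
  have "(\<Sum>l<n. A $$ (r, l) * B $$ (l, c)) mod k = (\<Sum>l<n. A' $$ (r, l) * B' $$ (l, c)) mod k"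
    by (subst (1 2) mod_sum_eq [symmetric])
      (rule arg_cong[where f = "\<lambda>x. x mod k"], intro sum.cong refl mod_mult_cong A B; simp)
  then show "map_mat (\<lambda>a. a mod k) (A * B) $$ (r, c) = map_mat (\<lambda>a. a mod k) (A' * B') $$ (r, c)"
    using rc assms(1-4) by (auto simp: scalar_prod_def lessThan_atLeast0)
qed (use assms(1-4) in auto)

lemma subgroup_level_braid: "subgroup (level_braid n m) (braid_group n)"
proof -
  interpret G: group "braid_group n" by (rule group_braid_group)
  interpret hom: group_hom "braid_group n" "GL TYPE(int) n" "integral_burau n"
    by (intro group_hom.intro group_hom_axioms.intro group_braid_group group_GL integral_burau_hom)
  let ?r = "map_mat (\<lambda>a::int. a mod int m)"
  have mult: "x \<otimes>\<^bsub>GL TYPE(int) n\<^esub> y = x * y" and one: "\<one>\<^bsub>GL TYPE(int) n\<^esub> = 1\<^sub>m n" for x y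
    by (auto simp: GL_def units_of_def ring_mat_simps)
  have car: "integral_burau n x \<in> carrier_mat n n" if "x \<in> carrier (braid_group n)" for x
    using hom.hom_closed[OF that] by (auto simp: GL_def units_of_def Units_def ring_mat_simps)
  note cong = mod_mat_mult[where n = n and k = "int m"]
  show ?thesis
  proof (rule G.subgroupI)
    show "level_braid n m \<subseteq> carrier (braid_group n)" by (auto simp: level_braid_def)
    have "\<one>\<^bsub>braid_group n\<^esub> \<in> level_braid n m" by (simp add: level_braid_def one)
    then show "level_braid n m \<noteq> {}" by blast
    fix x assume "x \<in> level_braid n m"
    then have x: "x \<in> carrier (braid_group n)" "?r (integral_burau n x) = ?r (1\<^sub>m n)"
      by (auto simp: level_braid_def)
    let ?y = "inv\<^bsub>braid_group n\<^esub> x"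
    have y: "?y \<in> carrier (braid_group n)" using x by simp
    have "integral_burau n ?y * integral_burau n x = 1\<^sub>m n"
      using hom.hom_mult[OF y x(1)] G.l_inv[OF x(1)] by (simp add: mult one)
    then have "?r (1\<^sub>m n) = ?r (integral_burau n ?y * 1\<^sub>m n)"
      using cong[OF car[OF y] car[OF y] car[OF x(1)] one_carrier_mat refl x(2)] by simp
    then show "?y \<in> level_braid n m"
      using y right_mult_one_mat[OF car[OF y]] by (simp add: level_braid_def)
    fix z assume "z \<in> level_braid n m"
    then have z: "z \<in> carrier (braid_group n)" "?r (integral_burau n z) = ?r (1\<^sub>m n)"
      by (auto simp: level_braid_def)
    show "x \<otimes>\<^bsub>braid_group n\<^esub> z \<in> level_braid n m"
      using x z cong[OF car[OF x(1)] one_carrier_mat car[OF z(1)] one_carrier_mat x(2) z(2)]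
      by (simp add: level_braid_def mult)
  qed
qed

lemma lookup_map_mult [simp]:
  "Poly_Mapping.lookup (Poly_Mapping.map ((*) q) c) x = (q :: rat) * Poly_Mapping.lookup c x"
  by (simp add: Poly_Mapping.map.rep_eq when_def)

lemma boundary2_superset:
  assumes "finite K" "Poly_Mapping.keys c \<subseteq> K"
  shows "boundary2 G c = (\<Sum>(g, h)\<in>K. let q = Poly_Mapping.lookup c (g, h) in
     Poly_Mapping.single h q - Poly_Mapping.single (g \<otimes>\<^bsub>G\<^esub> h) q + Poly_Mapping.single g q)"
  unfolding boundary2_def using assms
  by (intro sum.mono_neutral_left) (auto simp: in_keys_iff)

lemma boundary2_add: "boundary2 G (c + d) = boundary2 G c + boundary2 G d"
proof -
  let ?K = "Poly_Mapping.keys c \<union> Poly_Mapping.keys d"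
  have "Poly_Mapping.keys (c + d) \<subseteq> ?K" by (rule Poly_Mapping.keys_add)
  then show ?thesis
    by (simp add: boundary2_superset[of ?K] Let_def lookup_add single_add case_prod_beta
      flip: sum.distrib) (simp add: algebra_simps)
qed

lemma map_mult_add:
  "Poly_Mapping.map ((*) q) (c + d) = Poly_Mapping.map ((*) q) c + Poly_Mapping.map ((*) (q :: rat)) d"
  by (rule poly_mapping_eqI) (simp add: lookup_add algebra_simps)

lemma map_mult_diff:
  "Poly_Mapping.map ((*) q) (c - d) = Poly_Mapping.map ((*) q) c - Poly_Mapping.map ((*) (q :: rat)) d"
  by (rule poly_mapping_eqI) (simp add: lookup_minus algebra_simps)

lemma map_mult_sum:
  "Poly_Mapping.map ((*) (q :: rat)) (\<Sum>x\<in>K. f x) = (\<Sum>x\<in>K. Poly_Mapping.map ((*) q) (f x))"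
  by (rule poly_mapping_eqI) (simp add: lookup_sum sum_distrib_left)

lemma map_mult_single:
  "Poly_Mapping.map ((*) (q :: rat)) (Poly_Mapping.single x a) = Poly_Mapping.single x (q * a)"
  by (rule poly_mapping_eqI) (simp add: lookup_single when_def)

lemma keys_map_mult: "Poly_Mapping.keys (Poly_Mapping.map ((*) (q :: rat)) c) \<subseteq> Poly_Mapping.keys c"
  by (auto simp: in_keys_iff)

lemma boundary2_scale:
  "boundary2 G (Poly_Mapping.map ((*) q) c) = Poly_Mapping.map ((*) q) (boundary2 G c)"
  by (simp add: boundary2_superset[OF _ keys_map_mult] boundary2_superset[of "Poly_Mapping.keys c" c]
    map_mult_sum Let_def case_prod_beta map_mult_add map_mult_diff map_mult_single)

lemma chains1_closed:
  "0 \<in> chains1 G"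
  "c \<in> chains1 G \<Longrightarrow> d \<in> chains1 G \<Longrightarrow> c + d \<in> chains1 G"
  "c \<in> chains1 G \<Longrightarrow> Poly_Mapping.map ((*) q) c \<in> chains1 G"
  using Poly_Mapping.keys_add[of c d] keys_map_mult[of q c] by (auto simp: chains1_def)

lemma boundaries1_closed:
  "0 \<in> boundaries1 G"
  "c \<in> boundaries1 G \<Longrightarrow> d \<in> boundaries1 G \<Longrightarrow> c + d \<in> boundaries1 G"
  "c \<in> boundaries1 G \<Longrightarrow> Poly_Mapping.map ((*) q) c \<in> boundaries1 G"
  "c \<in> boundaries1 G \<Longrightarrow> - c \<in> boundaries1 G"
proof -
  show "0 \<in> boundaries1 G"
    unfolding boundaries1_def by (rule image_eqI[of _ _ 0]) (auto simp: boundary2_def chains2_def)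
  show *: "Poly_Mapping.map ((*) q) c \<in> boundaries1 G" if "c \<in> boundaries1 G" for q c
  proof -
    from that obtain c' where c': "c' \<in> chains2 G" "c = boundary2 G c'"
      by (auto simp: boundaries1_def)
    then have "Poly_Mapping.map ((*) q) c' \<in> chains2 G"
      using keys_map_mult[of q c'] by (auto simp: chains2_def)
    with c' show ?thesis
      by (auto simp: boundaries1_def simp flip: boundary2_scale)
  qed
  have "Poly_Mapping.map ((*) (-1)) c = - c"
    by (rule poly_mapping_eqI) simp
  then show "c \<in> boundaries1 G \<Longrightarrow> - c \<in> boundaries1 G" using *[of c "-1"] by simp
  assume "c \<in> boundaries1 G" "d \<in> boundaries1 G"
  then obtain c' d' where "c' \<in> chains2 G" "d' \<in> chains2 G" "c = boundary2 G c'" "d = boundary2 G d'"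
    by (auto simp: boundaries1_def)
  moreover from this have "c' + d' \<in> chains2 G"
    using Poly_Mapping.keys_add[of c' d'] by (auto simp: chains2_def)
  ultimately show "c + d \<in> boundaries1 G"
    by (auto simp: boundaries1_def simp flip: boundary2_add)
qed

lemma boundaries1_subset_chains1: "group G \<Longrightarrow> boundaries1 G \<subseteq> chains1 G"
proof -
  assume "group G"
  then interpret group G .
  have single: "Poly_Mapping.single x a \<in> chains1 G" if "x \<in> carrier G" for x a
    using that by (auto simp: chains1_def)
  have diff: "c - d \<in> chains1 G" if "c \<in> chains1 G" "d \<in> chains1 G" for c d
    using that keys_diff[of c d] by (auto simp: chains1_def)
  have sum: "(\<Sum>x\<in>K. f x) \<in> chains1 G" if "\<And>x. x \<in> K \<Longrightarrow> f x \<in> chains1 G"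
    for K and f :: "'a \<times> 'a \<Rightarrow> 'a \<Rightarrow>\<^sub>0 rat"
    using that by (induction K rule: infinite_finite_induct) (auto simp: chains1_closed)
  show ?thesis
    by (auto simp: boundaries1_def boundary2_def chains2_def Let_def case_prod_beta
      intro!: sum chains1_closed(2) diff single)
qed

lemma H1_class_self: "c \<in> H1_class G c"
  unfolding H1_class_def using boundaries1_closed(1)[of G] by force

lemma H1_class_eq_iff: "H1_class G c = H1_class G d \<longleftrightarrow> c - d \<in> boundaries1 G"
proof
  assume "H1_class G c = H1_class G d"
  moreover have "c \<in> H1_class G c"
    by (rule H1_class_self)
  ultimately show "c - d \<in> boundaries1 G" by (auto simp: H1_class_def)
next
  assume *: "c - d \<in> boundaries1 G"
  show "H1_class G c = H1_class G d"
  proof (intro equalityI subsetI)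
    fix x assume "x \<in> H1_class G c"
    then obtain b where "b \<in> boundaries1 G" "x = c + b" by (auto simp: H1_class_def)
    then show "x \<in> H1_class G d" unfolding H1_class_def
      using boundaries1_closed(2)[OF * \<open>b \<in> _\<close>] by (intro CollectI exI[of _ "c - d + b"]) simp
  next
    fix x assume "x \<in> H1_class G d"
    then obtain b where "b \<in> boundaries1 G" "x = d + b" by (auto simp: H1_class_def)
    then show "x \<in> H1_class G c" unfolding H1_class_def
      using boundaries1_closed(2)[OF boundaries1_closed(4)[OF *] \<open>b \<in> _\<close>]
      by (intro CollectI exI[of _ "- (c - d) + b"]) simp
  qed
qed

lemma H1_add: "H1_class G c \<oplus>\<^bsub>H1 G\<^esub> H1_class G d = H1_class G (c + d)"
proof -
  have "H1_class G (x + y) = H1_class G (c + d)"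
    if x: "x \<in> H1_class G c" and y: "y \<in> H1_class G d" for x y
  proof -
    from x have "x - c \<in> boundaries1 G" by (auto simp: H1_class_def)
    moreover from y have "y - d \<in> boundaries1 G" by (auto simp: H1_class_def)
    ultimately have "(x - c) + (y - d) \<in> boundaries1 G" by (rule boundaries1_closed(2))
    then show ?thesis by (simp only: H1_class_eq_iff add_diff_add)
  qed
  then have "(\<Union>x\<in>H1_class G c. \<Union>y\<in>H1_class G d. H1_class G (x + y))
      = (\<Union>x\<in>H1_class G c. \<Union>y\<in>H1_class G d. H1_class G (c + d))"
    by (intro SUP_cong refl)
  also have "\<dots> = H1_class G (c + d)"
    using H1_class_self[of c G] H1_class_self[of d G] by (simp only: UN_constant) (metis empty_iff)
  finally show ?thesis by (simp add: H1_def)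
qed

lemma H1_smult: "q \<odot>\<^bsub>H1 G\<^esub> H1_class G c = H1_class G (Poly_Mapping.map ((*) q) c)"
proof -
  have "H1_class G (Poly_Mapping.map ((*) q) x) = H1_class G (Poly_Mapping.map ((*) q) c)"
    if x: "x \<in> H1_class G c" for x
  proof -
    from x have "x - c \<in> boundaries1 G" by (auto simp: H1_class_def)
    then have "Poly_Mapping.map ((*) q) (x - c) \<in> boundaries1 G" by (rule boundaries1_closed(3))
    then show ?thesis by (simp only: H1_class_eq_iff map_mult_diff)
  qed
  then have "(\<Union>x\<in>H1_class G c. H1_class G (Poly_Mapping.map ((*) q) x))
      = (\<Union>x\<in>H1_class G c. H1_class G (Poly_Mapping.map ((*) q) c))"
    by (intro SUP_cong refl)
  also have "\<dots> = H1_class G (Poly_Mapping.map ((*) q) c)"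
    using H1_class_self[of c G] by (simp only: UN_constant) (metis empty_iff)
  finally show ?thesis by (simp add: H1_def)
qed

lemma vectorspace_H1: "vectorspace (class_ring :: rat ring) (H1 G)"
proof -
  have car: "carrier (H1 G) = H1_class G ` chains1 G" and zero: "\<zero>\<^bsub>H1 G\<^esub> = H1_class G 0"
    by (auto simp: H1_def)
  have neg: "- c \<in> chains1 G" if "c \<in> chains1 G" for c
    using that by (simp add: chains1_def)
  have scale: "Poly_Mapping.map ((*) (p + q)) c = Poly_Mapping.map ((*) p) c + Poly_Mapping.map ((*) q) c"
    "Poly_Mapping.map ((*) (p * q)) c = Poly_Mapping.map ((*) p) (Poly_Mapping.map ((*) q) c)"
    "Poly_Mapping.map ((*) 1) c = c" for p q :: rat and c :: "'a \<Rightarrow>\<^sub>0 rat"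
    by (rule poly_mapping_eqI, simp add: lookup_add algebra_simps)+
  have "abelian_group (H1 G)"
  proof (rule abelian_groupI)
    fix x assume "x \<in> carrier (H1 G)"
    then obtain c where c: "c \<in> chains1 G" "x = H1_class G c" by (auto simp: car)
    then have "H1_class G (- c) \<in> carrier (H1 G)" "H1_class G (- c) \<oplus>\<^bsub>H1 G\<^esub> x = \<zero>\<^bsub>H1 G\<^esub>"
      using neg by (auto simp: car zero H1_add)
    then show "\<exists>y\<in>carrier (H1 G). y \<oplus>\<^bsub>H1 G\<^esub> x = \<zero>\<^bsub>H1 G\<^esub>" by blast
  qed (auto simp: car zero H1_add chains1_closed ac_simps)
  moreover have "module_axioms (class_ring :: rat ring) (H1 G)"
    by unfold_locales
      (auto simp: car H1_add H1_smult chains1_closed scale map_mult_add)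
  ultimately show ?thesis
    by (simp add: vectorspace_def module_def class_field field.axioms domain.axioms)
qed

end

theory Submission
  imports Defs "HOL-Library.Function_Algebras"
begin

text \<open>
  The image of the first rational homology of the braid Torelli group in that of the level \<open>m\<close>
  group is everything, so the dimensions of the latter are bounded by the dimension of the former.
  Equivalently, a homomorphism \<open>f\<close> from the level \<open>m\<close> group to \<open>\<rat>\<close> that kills the Torelli group
  is zero. For \<open>n \<ge> 5\<close> this is shown as follows.

  At \<open>t = -1\<close> the generators act as transvections along a chain of vectors \<open>v\<^sub>0, v\<^sub>1, \<dots>\<close>. Commutators
  in the Heisenberg group of unipotent maps fixing \<open>v\<^sub>0\<close> show that \<open>f\<close> kills a power of every
  transvection; hence the largest subgroup \<open>K\<close> of \<open>ker f\<close> normal in the braid group contains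
  the elements of sufficiently divisible level in the Heisenberg groups of \<open>v\<^sub>0\<close> and \<open>v\<^sub>1\<close>. A stable
  range argument with these shows that, for some \<open>N\<close>, every \<open>\<gamma>\<close> of level \<open>N\<close> can be multiplied by an
  element of \<open>K\<close> so as to fix \<open>v\<^sub>0\<close> and hence to commute with \<open>\<sigma>\<^sub>0\<close> modulo the Torelli group. So \<open>f\<close> is
  invariant under conjugation on the level \<open>N\<close> group, which has finite index, and the transfer
  extends a multiple of it to the whole braid group. The extension vanishes on the generators,
  because \<open>f\<close> vanishes on powers of them; therefore \<open>f = 0\<close>.
\<close>

section \<open>Heisenberg groups of an alternating form\<close>

text \<open>Take for \<open>t\<close> the product of the primes of \<open>a\<close> that do not
  divide \<open>b\<close>. Then every prime of \<open>a\<close> divides exactly one of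
  \<open>b\<close> and \<open>t * c\<close>, hence not their sum.\<close>

lemma exists_coprime_translate:
  fixes a b c :: int
  assumes "a \<noteq> 0" and gcd: "\<And>p. p dvd a \<Longrightarrow> p dvd b \<Longrightarrow> p dvd c \<Longrightarrow> is_unit p"
  shows "\<exists>t. coprime a (b + t * c)"
proof -
  let ?P = "{p \<in> prime_factors a. \<not> p dvd b}"
  have "\<not> p dvd b + \<Prod>?P * c" if p: "Factorial_Ring.prime p" "p dvd a" for p
  proof (cases "p dvd b")
    case True
    have "\<not> p dvd \<Prod>?P"
    proof
      assume "p dvd \<Prod>?P"
      then obtain q where q: "q \<in> ?P" "p dvd q"
        using p(1) by (subst (asm) prime_dvd_prod_iff) auto
      then have "p = q" using p(1) by (auto simp: in_prime_factors_iff intro: primes_dvd_imp_eq)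
      with True q show False by simp
    qed
    moreover have "\<not> p dvd c" using gcd[OF p(2) True] p(1) not_prime_unit by blast
    ultimately show ?thesis using p(1) True by (simp add: prime_dvd_mult_iff dvd_add_right_iff)
  next
    case False
    then have "p dvd \<Prod>?P"
      using p assms by (intro dvd_prodI) (auto simp: in_prime_factors_iff)
    then show ?thesis using False by (simp add: dvd_add_left_iff)
  qed
  moreover have "gcd a (b + \<Prod>?P * c) \<noteq> 0" using assms by simp
  ultimately have "is_unit (gcd a (b + \<Prod>?P * c))"
    using prime_divisor_exists[of "gcd a (b + \<Prod>?P * c)"] by auto
  then have "coprime a (b + \<Prod>?P * c)" by (simp only: is_unit_gcd)
  then show ?thesis by blast
qed

locale alternating_form = Modules.module scale
  for scale :: "int \<Rightarrow> 'v::ab_group_add \<Rightarrow> 'v" (infixr \<open>*s\<close> 75) +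
  fixes form :: "'v \<Rightarrow> 'v \<Rightarrow> int"
  assumes form_add_left: "form (x + y) z = form x z + form y z"
    and form_scale_left: "form (k *s x) z = k * form x z"
    and form_antisym: "form x y = - form y x"
begin

lemma form_add_right: "form x (y + z) = form x y + form x z"
  by (metis form_add_left form_antisym minus_add_distrib)

lemma form_scale_right: "form x (k *s y) = k * form x y"
  by (metis form_antisym form_scale_left mult_minus_right)

lemma form_self [simp]: "form x x = 0"
  using form_antisym[of x x] by simp

lemma form_minus_left: "form (- x) y = - form x y"
  using form_scale_left[of "-1" x y] by simp

lemma form_minus_right: "form x (- y) = - form x y"
  using form_scale_right[of x "-1" y] by simp

lemma form_diff_left: "form (x - y) z = form x z - form y z"
  using form_add_left[of x "- y" z] by (simp add: form_minus_left)

lemma form_diff_right: "form z (x - y) = form z x - form z y"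
  using form_add_right[of z x "- y"] by (simp add: form_minus_right)

lemma form_zero [simp]: "form 0 x = 0" "form x 0 = 0"
  using form_scale_left[of 0 0 x] form_scale_right[of x 0 0] by auto

lemmas form_simps = form_add_left form_add_right form_scale_left form_scale_right
  form_minus_left form_minus_right form_diff_left form_diff_right

text \<open>The unipotent maps fixing \<open>u\<close>: for \<open>w \<bottom> u\<close> they form a Heisenberg group with centre
  the powers of the transvection along \<open>u\<close>.\<close>

definition heis :: "'v \<Rightarrow> 'v \<Rightarrow> int \<Rightarrow> 'v \<Rightarrow> 'v" where
  "heis u w c x = x + form x u *s w + (form x w + c * form x u) *s u"

abbreviation transv :: "'v \<Rightarrow> int \<Rightarrow> 'v \<Rightarrow> 'v" where
  "transv u k \<equiv> heis u 0 k"

text \<open>The term \<open>form w' w\<close> is the cocycle of the central extension. It vanishes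
  for proportional directions, so powers and inverses are computed coordinatewise.\<close>

lemma heis_comp:
  assumes "form w u = 0" "form w' u = 0"
  shows "heis u w c \<circ> heis u w' c' = heis u (w + w') (c + c' + form w' w)"
  using assms form_antisym[of u w] by (simp add: fun_eq_iff heis_def form_simps algebra_simps)

lemma heis_commutator:
  assumes "form w u = 0" "form w' u = 0"
  shows "heis u w c \<circ> heis u w' c' \<circ> heis u (- w) (- c) \<circ> heis u (- w') (- c') = transv u (2 * form w' w)"
  using assms form_antisym[of w w'] by (simp add: heis_comp form_simps)

lemma heis_id: "heis u 0 0 = id"
  by (simp add: fun_eq_iff heis_def)

text \<open>A direction along \<open>u\<close> itself is central, so the coordinates are redundant:
  a multiple of \<open>u\<close> in the direction can be traded for a change of
  \<open>c\<close>.\<close>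

lemma heis_eq_transv: "heis u (k *s u) c = transv u (2 * k + c)"
  by (simp add: fun_eq_iff heis_def form_simps algebra_simps flip: scale_left_distrib)

lemma heis_funpow:
  assumes "form w u = 0"
  shows "heis u w c ^^ n = heis u (int n *s w) (int n * c)"
  using assms by (induction n) (simp_all add: heis_id heis_comp form_simps algebra_simps)

definition isometry :: "('v \<Rightarrow> 'v) \<Rightarrow> bool" where
  "isometry g \<longleftrightarrow> (\<forall>x y. g (x + y) = g x + g y) \<and> (\<forall>k x. g (k *s x) = k *s g x) \<and>
     (\<forall>x y. form (g x) (g y) = form x y)"

lemma isometryD:
  assumes "isometry g"
  shows "g (x + y) = g x + g y" "g (k *s x) = k *s g x" "form (g x) (g y) = form x y"
  using assms by (auto simp: isometry_def)

lemma isometry_heis: "form w u = 0 \<Longrightarrow> isometry (heis u w c)"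
proof -
  assume wu: "form w u = 0"
  then have uw: "form u w = 0" using form_antisym[of u w] by simp
  have "form (heis u w c x) (heis u w c y) = form x y" for x y
    using wu uw form_antisym[of u y] form_antisym[of w y]
    by (simp add: heis_def form_simps algebra_simps)
  then show ?thesis
    by (simp add: isometry_def) (simp add: heis_def form_simps algebra_simps)
qed

text \<open>Since \<open>g\<close> preserves the form, the pairings of \<open>g' x\<close> with
  \<open>u\<close> and \<open>w\<close> equal those of \<open>x\<close> with \<open>g u\<close> and
  \<open>g w\<close>.\<close>

lemma heis_conj:
  assumes "isometry g" "g \<circ> g' = id"
  shows "g \<circ> heis u w c \<circ> g' = heis (g u) (g w) c"
proof
  fix x
  have x: "g (g' x) = x" using assms(2) by (simp add: fun_eq_iff)
  have "form (g' x) u = form x (g u)" "form (g' x) w = form x (g w)"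
    using isometryD(3)[OF assms(1), of "g' x"] x by metis+
  with x show "(g \<circ> heis u w c \<circ> g') x = heis (g u) (g w) c x"
    using assms(1) by (simp add: isometry_def heis_def)
qed

end

section \<open>Chains of vectors whose neighbours pair to 1, and their transvections\<close>

locale chain_form = alternating_form scale form
  for scale :: "int \<Rightarrow> 'v::ab_group_add \<Rightarrow> 'v" (infixr \<open>*s\<close> 75) and form +
  fixes v :: "nat \<Rightarrow> 'v" and N :: nat
  assumes N: "4 \<le> N"
    and form_Suc: "Suc i < N \<Longrightarrow> form (v i) (v (Suc i)) = 1"
    and form_far: "Suc i < j \<Longrightarrow> j < N \<Longrightarrow> form (v i) (v j) = 0"
begin

lemma form_Suc': "Suc i < N \<Longrightarrow> form (v (Suc i)) (v i) = - 1"
  using form_Suc[of i] form_antisym[of "v i" "v (Suc i)"] by simp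

lemma form_far': "Suc i < j \<Longrightarrow> j < N \<Longrightarrow> form (v j) (v i) = 0"
  using form_far[of i j] form_antisym[of "v i" "v j"] by simp

abbreviation L :: "'v set" where "L \<equiv> span (v ` {..<N})"

lemma form_small:
  "form (v 0) (v (Suc 0)) = 1" "form (v (Suc 0)) (v 0) = -1"
  "form (v (Suc 0)) (v 2) = 1" "form (v 2) (v (Suc 0)) = -1"
  "form (v 2) (v 3) = 1" "form (v 3) (v 2) = -1"
  "form (v 0) (v 2) = 0" "form (v 2) (v 0) = 0"
  "form (v 0) (v 3) = 0" "form (v 3) (v 0) = 0"
  "form (v (Suc 0)) (v 3) = 0" "form (v 3) (v (Suc 0)) = 0"
  using N form_Suc[of 0] form_Suc[of 1] form_Suc[of 2] form_Suc'[of 0] form_Suc'[of 1] form_Suc'[of 2]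
    form_far[of 0 2] form_far[of 0 3] form_far[of 1 3] form_far'[of 0 2] form_far'[of 0 3] form_far'[of 1 3]
  by (simp_all add: numeral_2_eq_2 numeral_3_eq_3)

lemma v_in_L: "i < N \<Longrightarrow> v i \<in> L"
  by (simp add: span_base)

lemma transv_L: "x \<in> L \<Longrightarrow> i < N \<Longrightarrow> transv (v i) e x \<in> L"
  by (auto simp: heis_def intro!: span_add span_scale v_in_L)

text \<open>The shadow of the braid relation: it makes transvections along neighbouring vectors
  conjugate.\<close>

lemma transv_chain:
  assumes "Suc i < N"
  shows "transv (v i) 1 (transv (v (Suc i)) 1 (v i)) = v (Suc i)"
  using form_Suc[OF assms] form_Suc'[OF assms] by (simp add: heis_def form_simps)

lemma transv_square_shift:
  "transv (v (Suc 0)) 1 (transv (v 0) 1 (transv (v 0) 1 (transv (v (Suc 0)) 1 (v 2)))) = v 2 + 2 *s v 0"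
  using form_small scale_left_distrib[of 1 1 "v 0"] by (simp add: heis_def form_simps algebra_simps)

text \<open>Vectors that agree modulo \<open>u\<close> and are orthogonal to it have transvections
  whose quotient is unipotent and fixes \<open>u\<close>. Heisenberg elements that are not central
  are first obtained this way.\<close>

lemma transv_comp_shift:
  assumes "form q u = 0"
  shows "transv (q + k *s u) c \<circ> transv q (- c) = heis u ((c * k) *s q) (c * k * k)"
  using assms form_antisym[of u q]
  by (simp add: fun_eq_iff heis_def form_simps algebra_simps)

end

section \<open>Groups \<open>K\<close> normalised by the chain that contain a power of a
  transvection\<close>

locale normalized_chain = chain_form scale form v N
  for scale :: "int \<Rightarrow> 'v::ab_group_add \<Rightarrow> 'v" (infixr \<open>*s\<close> 75) and form v N +
  fixes K :: "('v \<Rightarrow> 'v) set" and q :: int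
  assumes K_id: "id \<in> K"
    and K_comp: "k \<in> K \<Longrightarrow> k' \<in> K \<Longrightarrow> k \<circ> k' \<in> K"
    and K_inv: "k \<in> K \<Longrightarrow> \<exists>k'\<in>K. k' \<circ> k = id"
    and K_conj: "k \<in> K \<Longrightarrow> i < N \<Longrightarrow> transv (v i) 1 \<circ> k \<circ> transv (v i) (- 1) \<in> K"
    and q_pos: "q > 0"
    and K_transv: "transv (v 0) q \<in> K"
begin

lemma K_funpow: "k \<in> K \<Longrightarrow> k ^^ n \<in> K"
  by (induction n) (auto intro: K_id K_comp)

lemma K_heis_minus:
  assumes "heis u w c \<in> K" "form w u = 0"
  shows "heis u (- w) (- c) \<in> K"
proof -
  obtain k where k: "k \<in> K" "k \<circ> heis u w c = id"
    using K_inv assms by blast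
  have "heis u w c \<circ> heis u (- w) (- c) = id"
    using assms by (simp add: heis_comp form_simps heis_id)
  then have "heis u (- w) (- c) = k" using k(2) by (metis comp_assoc comp_id id_comp)
  with k show ?thesis by simp
qed

lemma K_heis_scale:
  assumes "heis u w c \<in> K" "form w u = 0"
  shows "heis u (k *s w) (k * c) \<in> K"
proof -
  have nat: "heis u (int n *s w') (int n * c') \<in> K" if "heis u w' c' \<in> K" "form w' u = 0" for n w' c'
    using K_funpow[OF that(1), of n] by (simp add: heis_funpow[OF that(2)])
  show ?thesis
  proof (cases "k \<ge> 0")
    case True
    then show ?thesis using nat[OF assms, of "nat k"] by simp
  next
    case False
    then show ?thesis using nat[OF K_heis_minus[OF assms], of "nat (- k)"] assms(2)
      by (simp add: form_simps)
  qed
qed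

lemma K_heis_move:
  assumes "heis u w c \<in> K" "i < N"
  shows "heis (transv (v i) 1 u) (transv (v i) 1 w) c \<in> K"
proof -
  have "transv (v i) 1 \<circ> transv (v i) (- 1) = id"
    by (simp add: heis_comp heis_id)
  from heis_conj[OF isometry_heis this, of u w c] K_conj[OF assms] show ?thesis by simp
qed

lemma K_transv_move: "transv u c \<in> K \<Longrightarrow> i < N \<Longrightarrow> transv (transv (v i) 1 u) c \<in> K"
  using K_heis_move[of u 0 c i] by (simp add: heis_def)

lemma K_transv_chain: "i < N \<Longrightarrow> transv (v i) q \<in> K"
proof (induction i)
  case 0
  then show ?case by (simp add: K_transv)
next
  case (Suc i)
  then show ?case
    using K_transv_move[OF K_transv_move, of "v i" q "Suc i" i] by (simp add: transv_chain)
qed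

lemma K_transv_multiple: "i < N \<Longrightarrow> q dvd c \<Longrightarrow> transv (v i) c \<in> K"
  using K_heis_scale[OF K_transv_chain[of i]] by (auto simp: mult.commute elim!: dvdE)

text \<open>The word of \<open>transv_square_shift\<close> carries the \<open>q\<close>-th power of
  the transvection along \<open>v 2\<close> to the one along \<open>v 2 + 2 *s v 0\<close>; dividing
  by the original power leaves a Heisenberg element over \<open>v 0\<close>.\<close>

lemma K_heis_shift: "heis (v 0) ((2 * q) *s v 2) (4 * q) \<in> K"
proof -
  have "transv (v 2 + 2 *s v 0) q \<in> K"
    using K_transv_move[OF K_transv_move[OF K_transv_move[OF K_transv_move[OF K_transv_chain]]],
        of 2 "Suc 0" 0 0 "Suc 0"] N
    by (simp add: transv_square_shift)
  moreover have "transv (v 2) (- q) \<in> K" using K_transv_multiple[of 2 "- q"] N by simp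
  ultimately show ?thesis
    using transv_comp_shift[of "v 2" "v 0" 2 q] K_comp[of "transv (v 2 + 2 *s v 0) q" "transv (v 2) (- q)"] form_small
    by (simp add: mult.commute[of q])
qed

text \<open>The central coordinate is left open so that the set is a submodule. It is brought to 0
  only in \<open>K_heis_0\<close>, at the price of another factor \<open>q\<close>.\<close>

definition heis_dirs :: "'v set" where
  "heis_dirs = {w. form w (v 0) = 0 \<and> (\<exists>c. heis (v 0) w c \<in> K)}"

lemma subspace_heis_dirs: "subspace heis_dirs"
proof (rule subspaceI)
  show "0 \<in> heis_dirs" using K_id by (auto simp: heis_dirs_def intro!: exI[of _ 0] simp: heis_id)
  fix w assume "w \<in> heis_dirs"
  then obtain c where w: "form w (v 0) = 0" "heis (v 0) w c \<in> K" by (auto simp: heis_dirs_def)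
  then show "k *s w \<in> heis_dirs" for k
    using K_heis_scale[of "v 0" w c k] by (auto simp: heis_dirs_def form_simps)
  fix w' assume "w' \<in> heis_dirs"
  then obtain c' where w': "form w' (v 0) = 0" "heis (v 0) w' c' \<in> K" by (auto simp: heis_dirs_def)
  then show "w + w' \<in> heis_dirs"
    using w K_comp[of "heis (v 0) w c" "heis (v 0) w' c'"]
    by (auto simp: heis_dirs_def form_simps heis_comp)
qed

text \<open>The index 1 is left out because \<open>v 1\<close> is not orthogonal to
  \<open>v 0\<close>. From 2 on, the next transvection fixes \<open>v 0\<close> and adds
  \<open>v (Suc i)\<close> to \<open>v i\<close>, so a difference gives the next direction.\<close>

lemma heis_dirs_chain:
  assumes "i < N" "i \<noteq> 1"
  shows "(2 * q) *s v i \<in> heis_dirs"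
proof (cases "i = 0")
  case True
  \<comment> \<open>The coordinate \<open>- 4 * q\<close> cancels what the direction along
    \<open>v 0\<close> contributes to the centre, which leaves the identity.\<close>
  have "heis (v 0) ((2 * q) *s v 0) (- 4 * q) \<in> K"
    using K_id by (simp add: heis_eq_transv heis_id)
  then show ?thesis using True by (auto simp: heis_dirs_def form_simps)
next
  case False
  with assms have "2 \<le> i" by simp
  then show ?thesis using assms(1)
  proof (induction i rule: dec_induct)
    case base
    then show ?case using K_heis_shift form_small by (auto simp: heis_dirs_def form_simps)
  next
    case (step i)
    then have IH: "(2 * q) *s v i \<in> heis_dirs" by simp
    then obtain c where c: "heis (v 0) ((2 * q) *s v i) c \<in> K" by (auto simp: heis_dirs_def)
    have "transv (v (Suc i)) 1 (v 0) = v 0"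
      using step form_far[of 0 "Suc i"] by (simp add: heis_def)
    moreover have "transv (v (Suc i)) 1 ((2 * q) *s v i) = (2 * q) *s v i + (2 * q) *s v (Suc i)"
      using step form_Suc[of i] by (simp add: heis_def form_simps)
    ultimately have "heis (v 0) ((2 * q) *s v i + (2 * q) *s v (Suc i)) c \<in> K"
      using K_heis_move[OF c, of "Suc i"] step by simp
    then have "(2 * q) *s v i + (2 * q) *s v (Suc i) \<in> heis_dirs"
      using step form_far'[of 0 i] form_far'[of 0 "Suc i"] by (auto simp: heis_dirs_def form_simps)
    then show ?case using subspace_diff[OF subspace_heis_dirs _ IH] by fastforce
  qed
qed

text \<open>Of the chain only \<open>v 1\<close> pairs nontrivially with \<open>v 0\<close>, so
  pairing with \<open>v 0\<close> reads off its coefficient, and the complement is spanned by the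
  other vectors.\<close>

lemma heis_dirs_perp:
  assumes "w \<in> L" "form w (v 0) = 0"
  shows "(2 * q) *s w \<in> heis_dirs"
proof -
  let ?B = "v ` ({..<N} - {1})"
  have "v ` {..<N} = insert (v 1) ?B" using N by auto
  with assms(1) obtain k where k: "w - k *s v 1 \<in> span ?B"
    by (auto simp: span_breakdown_eq)
  have orth: "form x (v 0) = 0" if "x \<in> span ?B" for x
    using that
  proof (induction rule: span_induct_alt)
    case (step c x y)
    from step(1) obtain j where j: "x = v j" "j < N" "j \<noteq> 1" by auto
    then have "form x (v 0) = 0" using form_far'[of 0 j] by (cases "j = 0") auto
    with step(2) show ?case by (simp add: form_simps)
  qed simp
  have "k = 0" using orth[OF k] assms(2) form_small by (simp add: form_simps)
  with k have "w \<in> span ?B" by simp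
  then show ?thesis
  proof (induction rule: span_induct_alt)
    case base
    then show ?case using subspace_0[OF subspace_heis_dirs] by simp
  next
    case (step c x y)
    from step(1) have "(2 * q) *s x \<in> heis_dirs" using heis_dirs_chain by auto
    then have "c *s (2 * q) *s x + (2 * q) *s y \<in> heis_dirs"
      using step(2) subspace_heis_dirs subspace_add subspace_scale by blast
    then show ?case by (simp add: scale_right_distrib mult.commute)
  qed
qed

text \<open>Raising to the power \<open>q\<close> makes the unknown central coordinate a multiple of
  \<open>q\<close>, which a transvection in \<open>K\<close> removes.\<close>

lemma K_heis_0:
  assumes "w \<in> L" "form w (v 0) = 0"
  shows "heis (v 0) ((2 * q * q) *s w) 0 \<in> K"
proof -
  obtain c where "heis (v 0) ((2 * q) *s w) c \<in> K"
    using heis_dirs_perp[OF assms] by (auto simp: heis_dirs_def)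
  then have "heis (v 0) (q *s (2 * q) *s w) (q * c) \<in> K"
    using assms by (intro K_heis_scale) (auto simp: form_simps)
  from K_comp[OF this K_transv_multiple[of 0 "- (q * c)"]] show ?thesis
    using assms N by (simp add: heis_comp form_simps mult_ac)
qed

text \<open>The first two transvections carry \<open>v 0\<close> to \<open>v (Suc 0)\<close> and
  normalise \<open>K\<close>, so \<open>K_heis_0\<close> is applied to the preimage
  \<open>w'\<close> of \<open>w\<close>.\<close>

lemma K_heis_1:
  assumes "w \<in> L" "form w (v (Suc 0)) = 0"
  shows "heis (v (Suc 0)) ((2 * q * q) *s w) 0 \<in> K"
proof -
  define w' where "w' = transv (v (Suc 0)) (- 1) (transv (v 0) (- 1) w)"
  have inv: "transv (v i) 1 (transv (v i) (- 1) x) = x" for i x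
    using heis_comp[of 0 "v i" 0 1 "-1"] by (simp add: fun_eq_iff heis_id)
  have w: "transv (v 0) 1 (transv (v (Suc 0)) 1 w') = w"
    by (simp add: w'_def inv)
  have iso: "isometry (transv (v i) e)" for i e by (rule isometry_heis) simp
  have v1: "transv (v 0) 1 (transv (v (Suc 0)) 1 (v 0)) = v (Suc 0)"
    using transv_chain[of 0] N by simp
  have "form w' (v 0) = form w (v (Suc 0))"
    using isometryD(3)[OF iso, of 0 1 "transv (v (Suc 0)) 1 w'" "transv (v (Suc 0)) 1 (v 0)"]
      isometryD(3)[OF iso, of "Suc 0" 1 w' "v 0"] w v1 by simp
  moreover have "w' \<in> L" using assms N by (simp add: w'_def transv_L)
  ultimately have "heis (v 0) ((2 * q * q) *s w') 0 \<in> K" using assms by (simp add: K_heis_0)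
  from K_heis_move[OF K_heis_move[OF this, of "Suc 0"], of 0] show ?thesis
    using N v1 w by (simp add: isometryD(2)[OF iso])
qed


section \<open>Stable range argument in the complement of a hyperbolic plane\<close>

definition plane_perp :: "'v set" where
  "plane_perp = {w \<in> L. form w (v 0) = 0 \<and> form w (v (Suc 0)) = 0}"

lemma plane_perp_closed:
  "w \<in> plane_perp \<Longrightarrow> w' \<in> plane_perp \<Longrightarrow> w + w' \<in> plane_perp"
  "w \<in> plane_perp \<Longrightarrow> k *s w \<in> plane_perp"
  "0 \<in> plane_perp"
  by (auto simp: plane_perp_def form_simps span_add span_scale span_zero)

text \<open>The vectors \<open>v 0\<close> and \<open>v (Suc 0)\<close> pair to 1, so their plane
  splits off over the integers.\<close>

lemma plane_perp_proj:
  assumes "x \<in> L"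
  shows "x - form x (v (Suc 0)) *s v 0 - form (v 0) x *s v (Suc 0) \<in> plane_perp"
  using assms N form_antisym[of x "v 0"] form_small
  by (auto simp: plane_perp_def form_simps intro!: span_diff span_scale v_in_L)

definition level :: int where "level = 2 * q * q"

definition moves :: "'v \<Rightarrow> 'v \<Rightarrow> bool" where
  "moves x y \<longleftrightarrow> (\<exists>k\<in>K. k x = y)"

lemma moves_trans [trans]: "moves x y \<Longrightarrow> moves y z \<Longrightarrow> moves x z"
  unfolding moves_def using K_comp by (metis comp_apply)

text \<open>An elementary operation: \<open>y\<close> changes by a multiple of \<open>a\<close> at
  the cost of altering \<open>b\<close>. In \<open>moves_0\<close> the two coordinates exchange
  roles.\<close>

lemma moves_1:
  assumes "y \<in> plane_perp" "w \<in> plane_perp"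
    and "b' = b + level * form y w" "y' = y + (level * a) *s w"
  shows "moves (a *s v 0 + b *s v (Suc 0) + y) (a *s v 0 + b' *s v (Suc 0) + y')"
  unfolding moves_def
proof (rule bexI)
  show "heis (v (Suc 0)) (level *s w) 0 \<in> K"
    using K_heis_1[of w] assms by (simp add: plane_perp_def level_def)
  show "heis (v (Suc 0)) (level *s w) 0 (a *s v 0 + b *s v (Suc 0) + y) = a *s v 0 + b' *s v (Suc 0) + y'"
    using assms form_small form_antisym[of "v 0" w] form_antisym[of "v (Suc 0)" w]
    by (simp add: heis_def plane_perp_def form_simps algebra_simps)
qed

lemma moves_0:
  assumes "y \<in> plane_perp" "w \<in> plane_perp"
    and "a' = a + level * form y w" "y' = y - (level * b) *s w"
  shows "moves (a *s v 0 + b *s v (Suc 0) + y) (a' *s v 0 + b *s v (Suc 0) + y')"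
  unfolding moves_def
proof (rule bexI)
  show "heis (v 0) (level *s w) 0 \<in> K"
    using K_heis_0[of w] assms by (simp add: plane_perp_def level_def)
  show "heis (v 0) (level *s w) 0 (a *s v 0 + b *s v (Suc 0) + y) = a' *s v 0 + b *s v (Suc 0) + y'"
    using assms form_small form_antisym[of "v 0" w] form_antisym[of "v (Suc 0)" w]
    by (simp add: heis_def plane_perp_def form_simps algebra_simps)
qed

lemma moves_transv:
  assumes "q dvd c"
  shows "moves (a *s v 0 + b *s v (Suc 0)) (a *s v 0 + (b + a * c) *s v (Suc 0))"
  unfolding moves_def
proof (rule bexI)
  show "transv (v (Suc 0)) c \<in> K" using assms N by (simp add: K_transv_multiple)
  show "transv (v (Suc 0)) c (a *s v 0 + b *s v (Suc 0)) = a *s v 0 + (b + a * c) *s v (Suc 0)"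
    using form_small by (simp add: heis_def form_simps algebra_simps)
qed

text \<open>Stable range: the multiple \<open>t\<close> makes the coordinates \<open>a\<close>, \<open>b\<close> coprime; then \<open>y\<close> can be
  cleared and serves as workspace for replacing \<open>a\<close> by \<open>1\<close>.\<close>

lemma moves_to_v0:
  assumes x: "x - v 0 = (level * level) *s z" "z \<in> L" and x': "x' \<in> L" "form x x' = 1"
  shows "moves x (v 0)"
proof -
  define M where "M = level"
  define a where "a = form x (v (Suc 0))"
  define b where "b = form (v 0) x"
  define y0 where "y0 = z - form z (v (Suc 0)) *s v 0 - form (v 0) z *s v (Suc 0)"
  define a1 where "a1 = form x' (v (Suc 0))"
  define b1 where "b1 = form (v 0) x'"
  define y1 where "y1 = x' - a1 *s v 0 - b1 *s v (Suc 0)"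
  have M: "M > 1" using q_pos mult_mono[of 1 q 1 q] by (simp add: M_def level_def)
  have xz: "x = v 0 + (M * M) *s z" using x(1) by (simp add: M_def algebra_simps)
  have y0: "y0 \<in> plane_perp" and y1: "y1 \<in> plane_perp"
    unfolding y0_def y1_def a1_def b1_def by (intro plane_perp_proj x x')+
  have a: "a = 1 + M * (M * form z (v (Suc 0)))" and b: "b = M * (M * form (v 0) z)"
    using form_small by (simp_all add: a_def b_def xz form_simps)
  have x_eq: "x = a *s v 0 + b *s v (Suc 0) + (M * M) *s y0"
    by (simp add: xz a b y0_def algebra_simps)
  have x'_eq: "x' = a1 *s v 0 + b1 *s v (Suc 0) + y1"
    by (simp add: y1_def)
  have perp: "form w (v 0) = 0" "form w (v (Suc 0)) = 0" "form (v 0) w = 0" "form (v (Suc 0)) w = 0"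
    if "w \<in> plane_perp" for w
    using that form_antisym[of "v 0" w] form_antisym[of "v (Suc 0)" w] by (auto simp: plane_perp_def)
  \<comment> \<open>The pairing of \<open>x\<close> with \<open>x'\<close>, written in coordinates,
    is a Bezout relation between \<open>a\<close>, \<open>b\<close> and the part in the
    complement.\<close>
  have one: "1 = a * b1 - b * a1 + M * (M * form y0 y1)"
    using x'(2) form_small perp[OF y0] perp[OF y1] unfolding x_eq x'_eq
    by (simp add: form_simps algebra_simps)
  have a0: "a \<noteq> 0"
  proof
    assume "a = 0"
    then have "M dvd 1" using a by (metis add.commute dvd_0_right dvd_add_right_iff dvd_triv_left)
    then show False using M by simp
  qed
  \<comment> \<open>Since \<open>a\<close> is 1 modulo \<open>M\<close>, a common divisor of
    \<open>a\<close>, \<open>b\<close> and the multiplier of \<open>t\<close> is prime to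
    \<open>M\<close>, hence divides the right-hand side of \<open>one\<close>.\<close>
  obtain t where t: "coprime a (b + t * (M * (M * (M * form y0 y1))))"
  proof (rule exE[OF exists_coprime_translate[OF a0]])
    fix p assume p: "p dvd a" "p dvd b" "p dvd M * (M * (M * form y0 y1))"
    have "coprime a M" 
    proof (rule coprimeI)
      fix d assume "d dvd a" "d dvd M"
      then have "d dvd a - M * (M * form z (v (Suc 0)))" by simp
      then show "is_unit d" by (simp add: a)
    qed
    with p(1) have "coprime p M" by (rule coprime_divisors[OF _ dvd_refl])
    with p(3) have "p dvd M * (M * form y0 y1)" by (simp add: coprime_dvd_mult_right_iff)
    with p(1,2) have "p dvd a * b1 - b * a1 + M * (M * form y0 y1)" by simp
    then show "is_unit p" using one by simp
  qed
  define b' where "b' = b + t * (M * (M * (M * form y0 y1)))"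
  obtain r s where rs: "r * a + s * b' = 1"
    using t bezout_int[of a b'] unfolding b'_def by (metis coprime_iff_gcd_eq_1)
  \<comment> \<open>Moving by the direction \<open>t *s y1\<close> turns \<open>b\<close> into
    \<open>b'\<close> and the part in the complement into \<open>M *s y2\<close>.\<close>
  define y2 where "y2 = M *s y0 + (a * t) *s y1"
  have y2: "y2 \<in> plane_perp" unfolding y2_def by (intro plane_perp_closed y0 y1)
  define d where "d = - form z (v (Suc 0))"
  have d: "a = 1 - M * (M * d)" by (simp add: a d_def)
  \<comment> \<open>The vectors \<open>u\<close> and \<open>v 3\<close> form a pair in the
    complement with pairing 1. As \<open>a\<close> falls short of 1 by \<open>M * M * d\<close>, it
    is corrected by first creating \<open>(M * d) *s u\<close> and then pairing it with
    \<open>M *s v 3\<close>.\<close>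
  define u where "u = v 0 + v 2"
  have u: "u \<in> plane_perp" and v3: "v 3 \<in> plane_perp" and uv: "form u (v 3) = 1"
    using N form_small
    by (auto simp: u_def plane_perp_def form_simps intro!: span_add v_in_L)
  note closed = plane_perp_closed
  define w where "w = d *s u + (- b') *s v 3"
  have w: "w \<in> plane_perp" unfolding w_def by (intro closed u v3)
  have "moves x (a *s v 0 + b' *s v (Suc 0) + M *s y2)"
    unfolding x_eq
    by (rule moves_1[OF _ closed(2)[OF y1, of t]])
      (auto intro!: closed y0 simp: b'_def y2_def M_def form_simps algebra_simps)
  \<comment> \<open>In this move and the next the directions are multiples of \<open>y2\<close>,
    which pairs to 0 with itself. So \<open>a\<close> and \<open>b'\<close> stay fixed while their
    Bezout relation clears the remainder.\<close>
  also have "moves \<dots> (a *s v 0 + b' *s v (Suc 0) + (M * s * b') *s y2)"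
  proof (rule moves_1[OF _ closed(2)[OF y2, of "- r"]])
    have "M * s * b' = M * (1 - r * a)" using rs by (metis add_diff_cancel_left' mult.assoc)
    then show "(M * s * b') *s y2 = M *s y2 + (level * a) *s - r *s y2"
      by (simp only: \<open>M * s * b' = _\<close>) (simp add: M_def algebra_simps)
  qed (auto intro!: closed y2 simp: form_simps)
  also have "moves \<dots> (a *s v 0 + b' *s v (Suc 0) + 0)"
    by (rule moves_0[OF _ closed(2)[OF y2, of s]])
      (auto intro!: closed y2 simp: M_def form_simps algebra_simps)
  \<comment> \<open>The same Bezout relation, run backwards, builds \<open>(M * d) *s u\<close> in
    two moves.\<close>
  also have "moves \<dots> (a *s v 0 + b' *s v (Suc 0) + (M * a * (r * d)) *s u)"
    by (rule moves_1[OF _ closed(2)[OF u, of "r * d"]])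
      (auto intro!: closed u simp: M_def form_simps algebra_simps)
  also have "moves \<dots> (a *s v 0 + b' *s v (Suc 0) + (M * d) *s u)"
  proof (rule moves_0[OF _ closed(2)[OF u, of "- (s * d)"]])
    have "M * d = M * d * (r * a + s * b')" using rs by simp
    then have "M * d = M * a * (r * d) + M * b' * (s * d)" by (simp only: algebra_simps)
    then show "(M * d) *s u = (M * a * (r * d)) *s u - (level * b') *s - (s * d) *s u"
      by (simp only: \<open>M * d = M * a * (r * d) + _\<close>) (simp add: M_def algebra_simps)
  qed (auto intro!: closed u simp: form_simps)
  \<comment> \<open>Once the first coordinate is 1, a single move clears any multiple of
    \<open>M\<close>.\<close>
  also have "moves \<dots> (1 *s v 0 + b' *s v (Suc 0) + M *s w)"
    by (rule moves_0[OF _ v3])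
      (auto intro!: closed u simp: w_def d uv M_def form_simps algebra_simps)
  also have "moves \<dots> (1 *s v 0 + b' *s v (Suc 0) + 0)"
    by (rule moves_1[OF _ closed(2)[OF w, of "- 1"]])
      (auto intro!: closed w simp: M_def form_simps algebra_simps)
  also have "moves \<dots> (v 0)"
  proof -
    have "q dvd b'" by (auto simp: b'_def b M_def level_def)
    then show ?thesis using moves_transv[of "- b'" 1 b'] by simp
  qed
  finally show ?thesis .
qed

end

section \<open>Transfer of an invariant homomorphism\<close>

text \<open>This is the transfer, with cosets named by the labels \<open>c\<close>. For normal
  \<open>H\<close> and invariant \<open>f\<close> every coset contributes \<open>f x\<close>, so on
  \<open>H\<close> the sum is the index times \<open>f\<close>.\<close>

lemma (in group) transfer_invariant_hom:
  fixes f :: "'a \<Rightarrow> 'd::comm_ring_1" and c :: "'a \<Rightarrow> 'e"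
  assumes H: "subgroup H G"
    and f: "\<And>x y. x \<in> H \<Longrightarrow> y \<in> H \<Longrightarrow> f (x \<otimes> y) = f x + f y"
    and c: "\<And>x y. x \<in> carrier G \<Longrightarrow> y \<in> carrier G \<Longrightarrow> c x = c y \<longleftrightarrow> inv x \<otimes> y \<in> H"
    and fin: "finite (c ` carrier G)"
    and normal: "\<And>g x. g \<in> carrier G \<Longrightarrow> x \<in> H \<Longrightarrow> g \<otimes> x \<otimes> inv g \<in> H"
    and invariant: "\<And>g x. g \<in> carrier G \<Longrightarrow> x \<in> H \<Longrightarrow> f (g \<otimes> x \<otimes> inv g) = f x"
  shows "\<exists>F. (\<forall>x\<in>carrier G. \<forall>y\<in>carrier G. F (x \<otimes> y) = F x + F y) \<and>
    (\<forall>x\<in>H. F x = of_nat (card (c ` carrier G)) * f x)"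
proof -
  let ?S = "c ` carrier G"
  define s where "s = inv_into (carrier G) c"
  have s: "s l \<in> carrier G" "c (s l) = l" if "l \<in> ?S" for l
    using that by (auto simp: s_def inv_into_into f_inv_into_f)
  \<comment> \<open>\<open>p\<close> measures \<open>x\<close> against the representative of its
    coset and is equivariant under right multiplication by \<open>H\<close>.\<close>
  define p where "p x = f (inv (s (c x)) \<otimes> x)" for x
  have rep: "s (c x) \<in> carrier G" "inv (s (c x)) \<otimes> x \<in> H" if "x \<in> carrier G" for x
    using that s[of "c x"] c[of "s (c x)" x] by auto
  have H_carrier: "x \<in> carrier G" if "x \<in> H" for x
    using that H subgroup.subset by blast
  have p_mult: "p (x \<otimes> h) = p x + f h" if x: "x \<in> carrier G" and h: "h \<in> H" for x h
  proof -
    have "c (x \<otimes> h) = c x"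
      using c[of x "x \<otimes> h"] x h H_carrier[OF h] by (simp add: m_assoc[symmetric])
    then show ?thesis
      using f[OF rep(2)[OF x] h] rep(1)[OF x] x H_carrier[OF h] by (simp add: p_def m_assoc)
  qed
  define F where "F x = (\<Sum>l\<in>?S. p (x \<otimes> s l))" for x
  have "F (x \<otimes> y) = F x + F y" if x: "x \<in> carrier G" and y: "y \<in> carrier G" for x y
  proof -
    \<comment> \<open>Left multiplication by \<open>y\<close> permutes the cosets, which allows
      reindexing the sum for \<open>x\<close>.\<close>
    let ?t = "\<lambda>l. c (y \<otimes> s l)"
    have "inj_on ?t ?S"
    proof (rule inj_onI)
      fix k l assume kl: "k \<in> ?S" "l \<in> ?S" "?t k = ?t l"
      then have "inv (y \<otimes> s k) \<otimes> (y \<otimes> s l) \<in> H"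
        using c[of "y \<otimes> s k" "y \<otimes> s l"] s y by simp
      also have "inv (y \<otimes> s k) \<otimes> (y \<otimes> s l) = inv (s k) \<otimes> s l"
        using s kl y by (simp add: inv_mult_group m_assoc inv_solve_left')
      finally have "c (s k) = c (s l)" using c[of "s k" "s l"] s kl by simp
      then show "k = l" using s kl by simp
    qed
    moreover have "?t ` ?S \<subseteq> ?S" using s y by auto
    ultimately have bij: "bij_betw ?t ?S ?S"
      using fin by (simp add: bij_betw_def endo_inj_surj)
    have "p (x \<otimes> y \<otimes> s l) = p (x \<otimes> s (?t l)) + p (y \<otimes> s l)" if l: "l \<in> ?S" for l
    proof -
      have ysl: "y \<otimes> s l \<in> carrier G" using s l y by simp
      define h where "h = inv (s (?t l)) \<otimes> (y \<otimes> s l)"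
      have h: "h \<in> H" "s (?t l) \<in> carrier G" using rep[OF ysl] by (simp_all add: h_def)
      then have "x \<otimes> y \<otimes> s l = x \<otimes> s (?t l) \<otimes> h"
        using x y s l ysl by (simp add: h_def m_assoc inv_solve_left' m_assoc[symmetric, of _ "inv _"])
      then show ?thesis using p_mult[of "x \<otimes> s (?t l)" h] h x by (simp add: p_def h_def)
    qed
    then have "F (x \<otimes> y) = (\<Sum>l\<in>?S. p (x \<otimes> s (?t l))) + F y"
      by (simp add: F_def sum.distrib)
    also have "(\<Sum>l\<in>?S. p (x \<otimes> s (?t l))) = F x"
      unfolding F_def by (rule sum.reindex_bij_betw[OF bij])
    finally show ?thesis .
  qed
  moreover have "F x = of_nat (card ?S) * f x" if x: "x \<in> H" for x
  proof -
    have "p (x \<otimes> s l) = f x" if l: "l \<in> ?S" for l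
    proof -
      have conj: "inv (s l) \<otimes> x \<otimes> s l \<in> H" "f (inv (s l) \<otimes> x \<otimes> s l) = f x"
        using normal[of "inv (s l)" x] invariant[of "inv (s l)" x] x s[OF l] by auto
      have "c (s l) = c (x \<otimes> s l)"
        using c[of "s l" "x \<otimes> s l"] conj s[OF l] H_carrier[OF x] by (simp add: m_assoc)
      then show ?thesis using conj s[OF l] H_carrier[OF x] by (simp add: p_def m_assoc)
    qed
    then show ?thesis by (simp add: F_def)
  qed
  ultimately show ?thesis by blast
qed

section \<open>The action of the braid group\<close>

definition letter :: "nat \<Rightarrow> nat \<times> bool \<Rightarrow> braid_word set" where
  "letter n g = braid_eq n `` {[g]}"

lemma letter_carrier: "Suc i < n \<Longrightarrow> letter n (i, b) \<in> carrier (braid_group n)"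
  by (simp add: letter_def braid_group_carrierI)

lemma braid_group_induct [consumes 1, case_names one letter]:
  assumes "x \<in> carrier (braid_group n)"
    and "P \<one>\<^bsub>braid_group n\<^esub>"
    and "\<And>i b y. Suc i < n \<Longrightarrow> y \<in> carrier (braid_group n) \<Longrightarrow> P y \<Longrightarrow>
      P (letter n (i, b) \<otimes>\<^bsub>braid_group n\<^esub> y)"
  shows "P x"
proof -
  obtain u where "u \<in> braid_words n" "x = braid_eq n `` {u}"
    using assms(1) by (rule braid_group_carrierE)
  moreover have "P (braid_eq n `` {u})" if "u \<in> braid_words n" for u
    using that
  proof (induction u)
    case Nil
    then show ?case using assms(2) by (simp add: braid_group_def)
  next
    case (Cons g u)
    obtain i b where "g = (i, b)" by (cases g)
    with Cons show ?case
      using assms(3)[of i "braid_eq n `` {u}" b] braid_group_mult[of "[g]" n u]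
      by (simp add: letter_def braid_group_carrierI)
  qed
  ultimately show ?thesis by blast
qed

lemma letter_inverse:
  assumes "Suc i < n"
  shows "letter n (i, b) \<otimes>\<^bsub>braid_group n\<^esub> letter n (i, \<not> b) = \<one>\<^bsub>braid_group n\<^esub>"
  using braid_eq.cancel[of "[]" n "[]" i b] assms
  by (simp add: letter_def braid_group_mult equiv_class_eq[OF equiv_braid_eq]) (simp add: braid_group_def)

lemma letter_braid:
  assumes "Suc (Suc i) < n"
  defines "s \<equiv> letter n (i, True)" and "t \<equiv> letter n (Suc i, True)"
  shows "s \<otimes>\<^bsub>braid_group n\<^esub> t \<otimes>\<^bsub>braid_group n\<^esub> s = t \<otimes>\<^bsub>braid_group n\<^esub> s \<otimes>\<^bsub>braid_group n\<^esub> t"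
  using braid_eq.braid[of "[]" n "[]" i] assms
  by (simp add: letter_def braid_group_mult equiv_class_eq[OF equiv_braid_eq])

text \<open>With \<open>g\<close> the product of two neighbouring generators \<open>s\<close> and
  \<open>t\<close>, the braid relation reads \<open>t g = g s\<close>, so neighbours are
  conjugate.\<close>

lemma letter_conjugate:
  assumes "Suc i < n"
  shows "\<exists>h\<in>carrier (braid_group n).
    letter n (i, True) = h \<otimes>\<^bsub>braid_group n\<^esub> letter n (0, True) \<otimes>\<^bsub>braid_group n\<^esub> inv\<^bsub>braid_group n\<^esub> h"
  using assms
proof (induction i)
  interpret group "braid_group n" by (rule group_braid_group)
  {
    case 0
    then show ?case using letter_carrier[of 0 n True] by (intro bexI[of _ "\<one>\<^bsub>braid_group n\<^esub>"]) auto
  next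
    case (Suc i)
    let ?s = "letter n (i, True)" and ?t = "letter n (Suc i, True)" and ?z = "letter n (0, True)"
    have st: "?s \<in> carrier (braid_group n)" "?t \<in> carrier (braid_group n)" "?z \<in> carrier (braid_group n)"
      using Suc by (auto intro: letter_carrier)
    obtain h where h: "h \<in> carrier (braid_group n)"
      "?s = h \<otimes>\<^bsub>braid_group n\<^esub> ?z \<otimes>\<^bsub>braid_group n\<^esub> inv\<^bsub>braid_group n\<^esub> h"
      using Suc by auto
    let ?g = "?s \<otimes>\<^bsub>braid_group n\<^esub> ?t"
    have "?t \<otimes>\<^bsub>braid_group n\<^esub> ?g = ?g \<otimes>\<^bsub>braid_group n\<^esub> ?s"
      using letter_braid[of i n] Suc.prems st by (simp add: m_assoc)
    then have "?t = ?g \<otimes>\<^bsub>braid_group n\<^esub> ?s \<otimes>\<^bsub>braid_group n\<^esub> inv\<^bsub>braid_group n\<^esub> ?g"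
      using st by (metis inv_solve_right m_closed)
    also have "\<dots> = ?g \<otimes>\<^bsub>braid_group n\<^esub> h \<otimes>\<^bsub>braid_group n\<^esub> ?z \<otimes>\<^bsub>braid_group n\<^esub> inv\<^bsub>braid_group n\<^esub> (?g \<otimes>\<^bsub>braid_group n\<^esub> h)"
    proof -
      have "?g \<in> carrier (braid_group n)" using st by simp
      then show ?thesis
        by (subst h(2), use h(1) st(3) in \<open>simp add: inv_mult_group m_assoc\<close>)
    qed
    finally show ?case using h st by blast
  }
qed

section \<open>The Burau lattice and its alternating form at t = -1\<close>

definition fun_scale :: "int \<Rightarrow> (nat \<Rightarrow> int) \<Rightarrow> nat \<Rightarrow> int" where
  "fun_scale k x = (\<lambda>r. k * x r)"

text \<open>The signs are forced by \<open>burau_form n x (chain_vec i) = x i - x (Suc i)\<close>: at \<open>t = -1\<close> the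
  generator \<open>\<sigma>\<^sub>i\<close> acts as the transvection along \<open>chain_vec i\<close>.\<close>

definition form_coeff :: "nat \<Rightarrow> nat \<Rightarrow> int" where
  "form_coeff j k = (if j < k then - ((-1) ^ (j + k)) else if k < j then (-1) ^ (j + k) else 0)"

definition burau_form :: "nat \<Rightarrow> (nat \<Rightarrow> int) \<Rightarrow> (nat \<Rightarrow> int) \<Rightarrow> int" where
  "burau_form n x y = (\<Sum>j<n. \<Sum>k<n. form_coeff j k * (x j * y k))"

definition chain_vec :: "nat \<Rightarrow> nat \<Rightarrow> int" where
  "chain_vec i = (\<lambda>r. if r = i \<or> r = Suc i then 1 else 0)"

text \<open>Vectors are functions on all of \<open>nat\<close>; fixing the coordinates from
  \<open>n\<close> on makes the identity braid act as \<open>id\<close> on the whole type.\<close>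

definition act :: "nat \<Rightarrow> braid_word set \<Rightarrow> (nat \<Rightarrow> int) \<Rightarrow> nat \<Rightarrow> int" where
  "act n x v = (\<lambda>r. if r < n then \<Sum>k<n. integral_burau n x $$ (r, k) * v k else v r)"

lemma alternating_form_burau: "alternating_form fun_scale (burau_form n)"
proof
  fix x y z :: "nat \<Rightarrow> int" and k :: int
  show "burau_form n (x + y) z = burau_form n x z + burau_form n y z"
    by (simp add: burau_form_def algebra_simps sum.distrib)
  show "burau_form n (fun_scale k x) z = k * burau_form n x z"
    by (simp add: burau_form_def fun_scale_def sum_distrib_left algebra_simps)
  have "burau_form n x y = (\<Sum>j<n. \<Sum>k<n. form_coeff k j * (x k * y j))"
    unfolding burau_form_def by (rule sum.swap)
  also have "\<dots> = - burau_form n y x"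
    by (simp add: burau_form_def sum_negf[symmetric])
      (intro sum.cong refl, simp add: form_coeff_def add.commute)
  finally show "burau_form n x y = - burau_form n y x" .
qed (simp_all add: fun_scale_def fun_eq_iff algebra_simps)

text \<open>For \<open>j\<close> outside \<open>i\<close> and \<open>Suc i\<close> the two
  coefficients have opposite signs and cancel; the two remaining rows give the difference.\<close>

lemma burau_form_chain_vec:
  assumes "Suc i < n"
  shows "burau_form n x (chain_vec i) = x i - x (Suc i)"
proof -
  have "(\<Sum>k<n. form_coeff j k * (x j * chain_vec i k)) = x j * (form_coeff j i + form_coeff j (Suc i))" for j
  proof -
    have "(\<Sum>k<n. form_coeff j k * (x j * chain_vec i k))
        = (\<Sum>k\<in>{i, Suc i}. form_coeff j k * (x j * chain_vec i k))"
      using assms by (intro sum.mono_neutral_right) (auto simp: chain_vec_def)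
    then show ?thesis by (simp add: chain_vec_def algebra_simps)
  qed
  moreover have "x j * (form_coeff j i + form_coeff j (Suc i))
      = (if j = i then x j else 0) - (if j = Suc i then x j else 0)" for j
    by (auto simp: form_coeff_def not_less less_Suc_eq)
  ultimately have "burau_form n x (chain_vec i)
      = (\<Sum>j<n. (if j = i then x j else 0) - (if j = Suc i then x j else 0))"
    by (simp add: burau_form_def)
  also have "\<dots> = x i - x (Suc i)" using assms by (simp add: sum_subtractf sum.delta)
  finally show ?thesis .
qed

lemma chain_form_burau:
  assumes "5 \<le> n"
  shows "chain_form fun_scale (burau_form n) chain_vec (n - Suc 0)"
proof -
  interpret alternating_form fun_scale "burau_form n" by (rule alternating_form_burau)
  show ?thesis
  proof
    show "4 \<le> n - Suc 0" using assms by simp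
  qed (simp_all add: burau_form_chain_vec, simp_all add: chain_vec_def)
qed

definition alt_sum :: "nat \<Rightarrow> (nat \<Rightarrow> int) \<Rightarrow> int" where
  "alt_sum n x = (\<Sum>j<n. (-1) ^ j * x j)"

lemma span_chain_vec:
  "Modules.module.span fun_scale (chain_vec ` {..<n}) = {x. (\<forall>r>n. x r = 0) \<and> alt_sum (Suc n) x = 0}"
proof -
  interpret Modules.module fun_scale
    using alternating_form_burau[of n] by (simp add: alternating_form_def)
  show ?thesis
  proof (intro equalityI subsetI)
    fix x assume "x \<in> span (chain_vec ` {..<n})"
    then show "x \<in> {x. (\<forall>r>n. x r = 0) \<and> alt_sum (Suc n) x = 0}"
    proof (induction rule: span_induct_alt)
      case base
      show ?case by (simp add: alt_sum_def)
    next
      case (step c w y)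
      then obtain i where i: "w = chain_vec i" "i < n" by auto
      have "alt_sum (Suc n) w = (\<Sum>j\<in>{i, Suc i}. (-1) ^ j * w j)"
        unfolding alt_sum_def using i by (intro sum.mono_neutral_right) (auto simp: chain_vec_def)
      then have "alt_sum (Suc n) w = 0" by (simp add: i(1) chain_vec_def)
      moreover have "alt_sum (Suc n) (fun_scale c w + y) = c * alt_sum (Suc n) w + alt_sum (Suc n) y"
        unfolding alt_sum_def by (simp add: fun_scale_def sum.distrib sum_distrib_left algebra_simps del: sum.lessThan_Suc)
      ultimately have "alt_sum (Suc n) (fun_scale c w + y) = 0" using step by simp
      moreover have "(fun_scale c w + y) r = 0" if "r > n" for r
        using that step i by (simp add: fun_scale_def chain_vec_def)
      ultimately show ?case by blast
    qed
  next
    fix x assume "x \<in> {x. (\<forall>r>n. x r = 0) \<and> alt_sum (Suc n) x = 0}"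
    then show "x \<in> span (chain_vec ` {..<n})"
    proof (induction n arbitrary: x)
      case 0
      then have "x r = 0" for r by (cases r) (auto simp: alt_sum_def)
      then have "x = 0" by (simp add: fun_eq_iff)
      then show ?case using span_zero by blast
    next
      case (Suc n)
      define y where "y = x - fun_scale (x (Suc n)) (chain_vec n)"
      have "y r = 0" if "r > n" for r
        using that Suc.prems by (cases "r = Suc n") (auto simp: y_def fun_scale_def chain_vec_def)
      moreover have "alt_sum (Suc n) y = 0"
      proof -
        have "(\<Sum>j<n. (-1) ^ j * y j) = (\<Sum>j<n. (-1) ^ j * x j)"
          by (intro sum.cong) (auto simp: y_def fun_scale_def chain_vec_def)
        then show ?thesis using Suc.prems
          by (simp add: alt_sum_def) (simp add: y_def fun_scale_def chain_vec_def algebra_simps)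
      qed
      ultimately have "y \<in> span (chain_vec ` {..<n})" using Suc.IH by simp
      moreover have "\<dots> \<subseteq> span (chain_vec ` {..<Suc n})" by (intro span_mono) auto
      moreover have "x = y + fun_scale (x (Suc n)) (chain_vec n)" by (simp add: y_def)
      ultimately show ?case
        by (metis (no_types, lifting) image_eqI lessThan_iff lessI span_add span_base span_scale subsetD)
    qed
  qed
qed

text \<open>The span is cut out by linear equations, so a nonzero factor can be cancelled. Hence
  displacements at level \<open>k\<close> can be divided by \<open>k\<close> inside
  \<open>L\<close>.\<close>

lemma span_chain_vec_saturated:
  assumes "fun_scale k x \<in> Modules.module.span fun_scale (chain_vec ` {..<n})" "k \<noteq> 0"
  shows "x \<in> Modules.module.span fun_scale (chain_vec ` {..<n})"
proof -
  have "alt_sum (Suc n) (fun_scale k x) = k * alt_sum (Suc n) x"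
    unfolding alt_sum_def by (simp add: fun_scale_def sum_distrib_left algebra_simps del: sum.lessThan_Suc)
  with assms show ?thesis by (simp add: span_chain_vec) (simp add: fun_scale_def)
qed

section \<open>The action on integer vectors and the level subgroups\<close>

lemma GL_simps:
  "x \<otimes>\<^bsub>GL TYPE('a::ring_1) n\<^esub> y = x * y" "\<one>\<^bsub>GL TYPE('a) n\<^esub> = 1\<^sub>m n"
  "A \<in> carrier (GL TYPE('a) n) \<Longrightarrow> A \<in> carrier_mat n n"
  by (auto simp: GL_def units_of_def Units_def ring_mat_simps)

lemma integral_burau_carrier:
  "x \<in> carrier (braid_group n) \<Longrightarrow> integral_burau n x \<in> carrier_mat n n"
  using hom_in_carrier[OF integral_burau_hom] GL_simps(3) by blast

lemma integral_burau_mult: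
  assumes "x \<in> carrier (braid_group n)" "y \<in> carrier (braid_group n)"
  shows "integral_burau n (x \<otimes>\<^bsub>braid_group n\<^esub> y) = integral_burau n x * integral_burau n y"
  using hom_mult[OF integral_burau_hom assms] by (simp add: GL_simps)

lemma integral_burau_one: "integral_burau n \<one>\<^bsub>braid_group n\<^esub> = 1\<^sub>m n"
  using hom_one[OF integral_burau_hom group_braid_group group_GL] by (simp add: GL_simps)

lemma integral_burau_mult_index:
  assumes "x \<in> carrier (braid_group n)" "y \<in> carrier (braid_group n)" "r < n" "k < n"
  shows "integral_burau n (x \<otimes>\<^bsub>braid_group n\<^esub> y) $$ (r, k)
    = (\<Sum>l<n. integral_burau n x $$ (r, l) * integral_burau n y $$ (l, k))"
  using assms(3,4) integral_burau_carrier[OF assms(1)] integral_burau_carrier[OF assms(2)]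
  by (simp add: integral_burau_mult[OF assms(1,2)] scalar_prod_def lessThan_atLeast0)

lemma act_mult:
  assumes "x \<in> carrier (braid_group n)" "y \<in> carrier (braid_group n)"
  shows "act n (x \<otimes>\<^bsub>braid_group n\<^esub> y) = act n x \<circ> act n y"
proof (intro ext)
  fix v r
  show "act n (x \<otimes>\<^bsub>braid_group n\<^esub> y) v r = (act n x \<circ> act n y) v r"
  proof (cases "r < n")
    case True
    let ?X = "integral_burau n x" and ?Y = "integral_burau n y"
    have "(\<Sum>k<n. integral_burau n (x \<otimes>\<^bsub>braid_group n\<^esub> y) $$ (r, k) * v k)
        = (\<Sum>k<n. \<Sum>l<n. ?X $$ (r, l) * (?Y $$ (l, k) * v k))"
      by (intro sum.cong refl) (simp add: integral_burau_mult_index[OF assms True] sum_distrib_right mult.assoc)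
    also have "\<dots> = (\<Sum>l<n. \<Sum>k<n. ?X $$ (r, l) * (?Y $$ (l, k) * v k))" by (rule sum.swap)
    finally show ?thesis using True by (simp add: act_def sum_distrib_left)
  qed (simp add: act_def)
qed

lemma act_one: "act n \<one>\<^bsub>braid_group n\<^esub> = id"
proof (intro ext)
  fix v :: "nat \<Rightarrow> int" and r
  have "(\<Sum>k<n. 1\<^sub>m n $$ (r, k) * v k) = v r" if "r < n"
  proof -
    have "(\<Sum>k<n. 1\<^sub>m n $$ (r, k) * v k) = (\<Sum>k<n. if k = r then v k else 0)"
      using that by (intro sum.cong) auto
    then show ?thesis using that by simp
  qed
  then show "act n \<one>\<^bsub>braid_group n\<^esub> v r = id v r" by (simp add: act_def integral_burau_one)
qed

lemma act_linear:
  "act n x (v + w) = act n x v + act n x w"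
  "act n x (fun_scale k v) = fun_scale k (act n x v)"
  by (auto simp: act_def fun_eq_iff fun_scale_def algebra_simps sum.distrib sum_distrib_left)

lemma act_letter:
  assumes "Suc i < n"
  shows "act n (letter n (i, True)) v = v + fun_scale (v i - v (Suc i)) (chain_vec i)"
proof
  fix r
  have B: "integral_burau n (letter n (i, True)) = map_mat eval_minus_one (burau_gen n (i, True))"
    using assms right_mult_one_mat[OF burau_gen_carrier, of n "(i, True)"]
    by (simp add: integral_burau_def letter_def burau_class)
  show "act n (letter n (i, True)) v r = (v + fun_scale (v i - v (Suc i)) (chain_vec i)) r"
  proof (cases "r < n")
    case True
    have "integral_burau n (letter n (i, True)) $$ (r, k) * v k = (if k = r then v k else 0)
       + (chain_vec i r * ((if k = i then v k else 0) - (if k = Suc i then v k else 0)))" if "k < n" for k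
      using that True
      by (auto simp: B burau_gen_def chain_vec_def eval_minus_one.hom_minus eval_minus_one_single)
    then have "act n (letter n (i, True)) v r = (\<Sum>k<n. (if k = r then v k else 0)
       + (chain_vec i r * ((if k = i then v k else 0) - (if k = Suc i then v k else 0))))"
      using True by (simp add: act_def)
    also have "\<dots> = v r + chain_vec i r * (v i - v (Suc i))"
      using True assms by (simp add: sum.distrib sum_subtractf flip: sum_distrib_left)
    finally show ?thesis by (simp add: fun_scale_def mult.commute)
  qed (use assms in \<open>auto simp: act_def fun_scale_def chain_vec_def\<close>)
qed

text \<open>Unit vectors recover the matrix entries. In terms of displacements, conjugation and
  change of level need no matrix computations.\<close>

lemma level_braid_iff:
  "x \<in> level_braid n m \<longleftrightarrow>
    x \<in> carrier (braid_group n) \<and> (\<forall>v. \<exists>w. act n x v = v + fun_scale (int m) w)"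
proof (cases "x \<in> carrier (braid_group n)")
  case True
  let ?X = "integral_burau n x"
  have X: "?X \<in> carrier_mat n n" using True by (rule integral_burau_carrier)
  have "map_mat (\<lambda>a. a mod int m) ?X = map_mat (\<lambda>a. a mod int m) (1\<^sub>m n) \<longleftrightarrow>
     (\<forall>r<n. \<forall>k<n. int m dvd ?X $$ (r, k) - 1\<^sub>m n $$ (r, k))" (is "?L \<longleftrightarrow> ?D")
    using X by (auto simp: mat_eq_iff mod_eq_dvd_iff)
  moreover have "?D \<longleftrightarrow> (\<forall>v. \<exists>w. act n x v = v + fun_scale (int m) w)" (is "_ \<longleftrightarrow> ?A")
  proof
    assume D: ?D
    show ?A
    proof
      fix v
      have "int m dvd act n x v r - v r" for r
      proof (cases "r < n")
        case True
        have "v r = (\<Sum>k<n. 1\<^sub>m n $$ (r, k) * v k)"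
          using True fun_cong[OF fun_cong[OF act_one[of n], of v], of r]
          by (simp only: act_def integral_burau_one id_apply if_True)
        then have "act n x v r - v r = (\<Sum>k<n. (?X $$ (r, k) - 1\<^sub>m n $$ (r, k)) * v k)"
          using True by (simp add: act_def sum_subtractf left_diff_distrib)
        moreover have "int m dvd (\<Sum>k<n. (?X $$ (r, k) - 1\<^sub>m n $$ (r, k)) * v k)"
          using D True by (auto intro!: dvd_sum dvd_mult2)
        ultimately show ?thesis by simp
      qed (simp add: act_def)
      then have "act n x v = v + fun_scale (int m) (\<lambda>r. (act n x v r - v r) div int m)"
        by (simp add: fun_eq_iff fun_scale_def)
      then show "\<exists>w. act n x v = v + fun_scale (int m) w" by blast
    qed
  next
    assume A: ?A
    show ?D
    proof (intro allI impI)
      fix r k assume rk: "r < n" "k < n"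
      let ?e = "\<lambda>j. if j = k then 1 else 0 :: int"
      obtain w where "act n x ?e = ?e + fun_scale (int m) w" using A by blast
      then have "act n x ?e r = ?e r + int m * w r" by (simp add: fun_scale_def)
      moreover have "act n x ?e r = ?X $$ (r, k)"
        using rk by (simp add: act_def if_distrib cong: if_cong)
      ultimately show "int m dvd ?X $$ (r, k) - 1\<^sub>m n $$ (r, k)" using rk by auto
    qed
  qed
  ultimately show ?thesis using True by (simp add: level_braid_def)
qed (simp add: level_braid_def)

lemma braid_torelli_iff:
  "x \<in> braid_torelli n \<longleftrightarrow> x \<in> carrier (braid_group n) \<and> act n x = id"
proof (cases "x \<in> carrier (braid_group n)")
  case True
  have "integral_burau n x = 1\<^sub>m n" if A: "act n x = id"
  proof (rule eq_matI)
    fix r k assume "r < dim_row (1\<^sub>m n :: int mat)" "k < dim_col (1\<^sub>m n :: int mat)"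
    then have rk: "r < n" "k < n" by auto
    let ?e = "\<lambda>j. if j = k then 1 else 0 :: int"
    have "act n x ?e r = integral_burau n x $$ (r, k)"
      using rk by (simp add: act_def if_distrib cong: if_cong)
    then show "integral_burau n x $$ (r, k) = 1\<^sub>m n $$ (r, k)" using A rk by auto
  qed (use integral_burau_carrier[OF True] in auto)
  moreover have "act n x = id" if "integral_burau n x = 1\<^sub>m n"
  proof -
    have "act n x = act n \<one>\<^bsub>braid_group n\<^esub>"
      by (intro ext) (simp add: act_def that integral_burau_one)
    then show ?thesis by (simp add: act_one)
  qed
  ultimately show ?thesis using True by (auto simp: braid_torelli_def kernel_def GL_simps)
qed (simp add: braid_torelli_def kernel_def)

lemma torelli_subset_level: "braid_torelli n \<subseteq> level_braid n m"
  by (auto simp: braid_torelli_iff level_braid_iff intro!: exI[of _ 0] simp: fun_scale_def fun_eq_iff)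

text \<open>The matrix modulo \<open>m\<close> names a coset of the level group; there are finitely
  many such matrices, which is how finite index enters.\<close>

definition level_label :: "nat \<Rightarrow> nat \<Rightarrow> braid_word set \<Rightarrow> int mat" where
  "level_label n m x = map_mat (\<lambda>a. a mod int m) (integral_burau n x)"

lemma finite_level_label:
  assumes "m \<ge> 1"
  shows "finite (level_label n m ` carrier (braid_group n))"
proof (rule finite_subset)
  let ?P = "({..<n} \<times> {..<n}) \<rightarrow>\<^sub>E {0..<int m}"
  show "level_label n m ` carrier (braid_group n) \<subseteq> mat n n ` ?P"
  proof
    fix A assume "A \<in> level_label n m ` carrier (braid_group n)"
    then obtain x where x: "x \<in> carrier (braid_group n)" "A = level_label n m x" by blast
    let ?g = "restrict (\<lambda>rk. integral_burau n x $$ rk mod int m) ({..<n} \<times> {..<n})"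
    have "A = mat n n ?g"
      using integral_burau_carrier[OF x(1)] by (auto simp: x(2) level_label_def intro!: eq_matI)
    moreover have "?g \<in> ?P" using assms by auto
    ultimately show "A \<in> mat n n ` ?P" by blast
  qed
  show "finite (mat n n ` ?P)" by (intro finite_imageI finite_PiE) auto
qed

lemma level_label_eq_iff:
  assumes x: "x \<in> carrier (braid_group n)" and y: "y \<in> carrier (braid_group n)"
  shows "level_label n m x = level_label n m y \<longleftrightarrow>
    inv\<^bsub>braid_group n\<^esub> x \<otimes>\<^bsub>braid_group n\<^esub> y \<in> level_braid n m"
proof -
  interpret group "braid_group n" by (rule group_braid_group)
  let ?X = "integral_burau n x" and ?X' = "integral_burau n (inv\<^bsub>braid_group n\<^esub> x)"
    and ?Y = "integral_burau n y" and ?r = "map_mat (\<lambda>a. a mod int m)"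
  let ?Z = "integral_burau n (inv\<^bsub>braid_group n\<^esub> x \<otimes>\<^bsub>braid_group n\<^esub> y)"
  have car: "?X \<in> carrier_mat n n" "?X' \<in> carrier_mat n n" "?Y \<in> carrier_mat n n" "?Z \<in> carrier_mat n n"
    using x y by (auto intro!: integral_burau_carrier)
  have Z: "?Z = ?X' * ?Y" and Y: "?Y = ?X * ?Z" and one: "?X' * ?X = 1\<^sub>m n"
    using x y integral_burau_one[of n]
    by (simp_all flip: integral_burau_mult m_assoc)
  have "?r ?Z = ?r (1\<^sub>m n)" if "?r ?X = ?r ?Y"
    using mod_mat_mult[OF car(2,2,3,1) refl that[symmetric]] Z one by simp
  moreover have "?r ?X = ?r ?Y" if "?r ?Z = ?r (1\<^sub>m n)"
    using mod_mat_mult[OF car(1,1,4) one_carrier_mat refl that] Y right_mult_one_mat[OF car(1)] by simp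
  ultimately show ?thesis using x y by (auto simp: level_label_def level_braid_def)
qed

section \<open>Homomorphisms from the level groups to the rationals\<close>

lemma subgroup_nat_pow:
  assumes "subgroup H G" "x \<in> H"
  shows "x [^]\<^bsub>G\<^esub> (k::nat) \<in> H"
  using assms by (induction k) (auto intro: subgroup.m_closed subgroup.one_closed simp: nat_pow_def)

locale level_hom =
  fixes n m :: nat and f :: "braid_word set \<Rightarrow> rat"
  assumes n: "5 \<le> n" and m: "1 \<le> m"
    and f_mult: "x \<in> level_braid n m \<Longrightarrow> y \<in> level_braid n m \<Longrightarrow>
      f (x \<otimes>\<^bsub>braid_group n\<^esub> y) = f x + f y"
    and f_torelli: "x \<in> braid_torelli n \<Longrightarrow> f x = 0"
begin

sublocale chain_form fun_scale "burau_form n" chain_vec "n - Suc 0"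
  using n by (rule chain_form_burau)

sublocale B: group "braid_group n"
  by (rule group_braid_group)

abbreviation carrierB where "carrierB \<equiv> carrier (braid_group n)"
abbreviation mult (infixl \<open>\<star>\<close> 70) where "x \<star> y \<equiv> x \<otimes>\<^bsub>braid_group n\<^esub> y"
abbreviation invB where "invB x \<equiv> inv\<^bsub>braid_group n\<^esub> x"
abbreviation conj where "conj g x \<equiv> g \<star> x \<star> invB g"
abbreviation \<sigma> where "\<sigma> i \<equiv> letter n (i, True)"

lemma \<sigma>_carrier [simp]: "Suc i < n \<Longrightarrow> \<sigma> i \<in> carrierB"
  by (rule letter_carrier)

lemma act_\<sigma>: "Suc i < n \<Longrightarrow> act n (\<sigma> i) = transv (chain_vec i) 1"
  by (simp add: act_letter burau_form_chain_vec heis_def fun_eq_iff)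

lemma act_inv:
  assumes "x \<in> carrierB"
  shows "act n x \<circ> act n (invB x) = id" "act n (invB x) \<circ> act n x = id"
  using assms by (simp_all add: act_one flip: act_mult)

lemma act_cancel:
  assumes "x \<in> carrierB"
  shows "act n x (act n (invB x) v) = v"
  using fun_cong[OF act_inv(1)[OF assms], of v] by simp

lemma act_inv_eq:
  assumes "x \<in> carrierB" "act n x \<circ> g = id"
  shows "act n (invB x) = g"
  using act_inv[OF assms(1)] assms(2) by (metis comp_assoc comp_id id_comp)

lemma act_inv_heis:
  assumes "x \<in> carrierB" "act n x = heis u w c" "burau_form n w u = 0"
  shows "act n (invB x) = heis u (- w) (- c)"
  by (rule act_inv_eq[OF assms(1)]) (use assms in \<open>simp add: heis_comp form_simps heis_id\<close>)

lemma act_conj: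
  "g \<in> carrierB \<Longrightarrow> x \<in> carrierB \<Longrightarrow> act n (conj g x) = act n g \<circ> act n x \<circ> act n (invB g)"
  by (simp add: act_mult)

lemma letter_False: "Suc i < n \<Longrightarrow> letter n (i, False) = invB (\<sigma> i)"
  using letter_inverse[of i n False] by (intro B.inv_equality[symmetric]) (auto simp: letter_carrier)

lemma act_letter_transv:
  assumes "Suc i < n"
  shows "act n (letter n (i, b)) = transv (chain_vec i) (if b then 1 else - 1)"
  using act_\<sigma>[OF assms] act_inv_heis[of "\<sigma> i" "chain_vec i" 0 1] assms
  by (cases b) (simp_all add: letter_False)

lemma isometry_act: "x \<in> carrierB \<Longrightarrow> isometry (act n x)"
proof (induction rule: braid_group_induct)
  case one
  then show ?case by (simp add: act_one isometry_def)
next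
  case (letter i b y)
  have "isometry (act n (letter n (i, b)))"
    using letter by (simp add: act_letter_transv isometry_heis)
  with letter show ?case by (simp add: act_mult letter_carrier isometry_def)
qed

lemma act_L: "x \<in> carrierB \<Longrightarrow> w \<in> L \<Longrightarrow> act n x w \<in> L"
proof (induction arbitrary: w rule: braid_group_induct)
  case (letter i b y)
  then have "transv (chain_vec i) (if b then 1 else - 1) (act n y w) \<in> L"
    by (intro transv_L) auto
  with letter show ?case by (simp add: act_mult letter_carrier act_letter_transv)
qed (simp add: act_one)

lemma level_carrier: "x \<in> level_braid n k \<Longrightarrow> x \<in> carrierB"
  by (simp add: level_braid_iff)

lemma level_conj:
  assumes g: "g \<in> carrierB" and x: "x \<in> level_braid n k"
  shows "conj g x \<in> level_braid n k"
proof -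
  have "\<exists>w. act n (conj g x) v = v + fun_scale (int k) w" for v
  proof -
    obtain w where w: "act n x (act n (invB g) v) = act n (invB g) v + fun_scale (int k) w"
      using x by (auto simp: level_braid_iff)
    have "act n (conj g x) v = act n g (act n (invB g) v + fun_scale (int k) w)"
      using g level_carrier[OF x] w by (simp add: act_conj)
    also have "\<dots> = v + fun_scale (int k) (act n g w)"
      by (simp only: act_linear act_cancel[OF g])
    finally show ?thesis by blast
  qed
  then show ?thesis using g level_carrier[OF x] by (simp add: level_braid_iff)
qed

lemma level_L:
  assumes "x \<in> level_braid n k" "k \<ge> 1" "w \<in> L"
  shows "\<exists>z\<in>L. act n x w - w = fun_scale (int k) z"
proof -
  obtain z where z: "act n x w = w + fun_scale (int k) z" using assms(1) by (auto simp: level_braid_iff)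
  then have eq: "act n x w - w = fun_scale (int k) z" by (simp only: add_diff_cancel_left')
  moreover have "act n x w - w \<in> L"
    using act_L[OF level_carrier[OF assms(1)] assms(3)] assms(3) by (rule span_diff)
  ultimately have "z \<in> L" using span_chain_vec_saturated[of "int k" z "n - Suc 0"] assms(2) by auto
  with eq show ?thesis by blast
qed

lemma f_one: "f \<one>\<^bsub>braid_group n\<^esub> = 0"
  using f_torelli by (simp add: braid_torelli_iff act_one)

lemma f_inv: "x \<in> level_braid n m \<Longrightarrow> f (invB x) = - f x"
  using f_mult[of x "invB x"] f_one subgroup.m_inv_closed[OF subgroup_level_braid, of x n m] level_carrier[of x m]
  by simp

lemma f_pow: "x \<in> level_braid n m \<Longrightarrow> f (x [^]\<^bsub>braid_group n\<^esub> (k::nat)) = of_nat k * f x"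
  using subgroup_nat_pow[OF subgroup_level_braid, of x n m]
  by (induction k) (simp_all add: f_one f_mult algebra_simps)

text \<open>The quotient of two elements with the same action is in the Torelli group, so
  \<open>f\<close> factors through the action.\<close>

lemma f_act_eq:
  assumes "x \<in> level_braid n m" "y \<in> level_braid n m" "act n x = act n y"
  shows "f x = f y"
proof -
  note car = level_carrier[OF assms(1)] level_carrier[OF assms(2)]
  have "x \<star> invB y \<in> braid_torelli n"
    using assms car act_inv(1)[OF car(2)] by (simp add: braid_torelli_iff act_mult)
  then have "f (x \<star> invB y) = 0" by (rule f_torelli)
  then show ?thesis
    using f_mult[of x "invB y"] f_inv assms subgroup.m_inv_closed[OF subgroup_level_braid] by simp
qed

text \<open>Requiring all conjugates to be killed makes the set normal in the braid group before
  \<open>f\<close> is known to be invariant under conjugation.\<close>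

definition core :: "braid_word set set" where
  "core = {x \<in> level_braid n m. \<forall>g\<in>carrierB. f (conj g x) = 0}"

lemma conj_mult: "g \<in> carrierB \<Longrightarrow> x \<in> carrierB \<Longrightarrow> y \<in> carrierB \<Longrightarrow> conj g (x \<star> y) = conj g x \<star> conj g y"
proof -
  assume *: "g \<in> carrierB" "x \<in> carrierB" "y \<in> carrierB"
  have "invB g \<star> (g \<star> (y \<star> invB g)) = y \<star> invB g"
    using * by (simp flip: B.m_assoc)
  then show ?thesis using * by (simp add: B.m_assoc)
qed

lemma conj_inv: "g \<in> carrierB \<Longrightarrow> x \<in> carrierB \<Longrightarrow> conj g (invB x) = invB (conj g x)"
  by (simp add: B.m_assoc B.inv_mult_group)

lemma conj_conj: "g \<in> carrierB \<Longrightarrow> h \<in> carrierB \<Longrightarrow> x \<in> carrierB \<Longrightarrow> conj g (conj h x) = conj (g \<star> h) x"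
  by (simp add: B.m_assoc B.inv_mult_group)

lemma conj_cancel: "g \<in> carrierB \<Longrightarrow> x \<in> carrierB \<Longrightarrow> conj g (conj (invB g) x) = x"
  by (simp only: conj_conj B.inv_closed B.r_inv) simp

lemma f_conj_mult:
  assumes "g \<in> carrierB" "x \<in> level_braid n m" "y \<in> level_braid n m"
  shows "f (conj g (x \<star> y)) = f (conj g x) + f (conj g y)"
  using assms by (simp add: conj_mult level_carrier f_mult level_conj)

lemma f_conj_inv:
  assumes "g \<in> carrierB" "x \<in> level_braid n m"
  shows "f (conj g (invB x)) = - f (conj g x)"
  using assms by (simp add: conj_inv level_carrier f_inv level_conj)

lemma core_level: "x \<in> core \<Longrightarrow> x \<in> level_braid n m"
  by (simp add: core_def)

lemma core_mult: "x \<in> core \<Longrightarrow> y \<in> core \<Longrightarrow> x \<star> y \<in> core"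
  by (auto simp: core_def f_conj_mult subgroup.m_closed[OF subgroup_level_braid])

lemma core_inv: "x \<in> core \<Longrightarrow> invB x \<in> core"
  by (auto simp: core_def f_conj_inv subgroup.m_inv_closed[OF subgroup_level_braid])

lemma core_conj: "x \<in> core \<Longrightarrow> g \<in> carrierB \<Longrightarrow> conj g x \<in> core"
  by (auto simp: core_def level_conj conj_conj level_carrier)

lemma core_f: "x \<in> core \<Longrightarrow> f x = 0"
  unfolding core_def using level_carrier[of x] B.one_closed by force

text \<open>Each \<open>f (conj g x)\<close> is a homomorphism in \<open>x\<close> to an abelian
  group.\<close>

lemma core_commutator:
  assumes "x \<in> level_braid n m" "y \<in> level_braid n m"
  shows "x \<star> y \<star> invB x \<star> invB y \<in> core"
  using assms
  by (auto simp: core_def f_conj_mult f_conj_inv subgroup.m_closed[OF subgroup_level_braid]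
    subgroup.m_inv_closed[OF subgroup_level_braid])

lemma act_pow: "x \<in> carrierB \<Longrightarrow> act n (x [^]\<^bsub>braid_group n\<^esub> (k::nat)) = act n x ^^ k"
proof (induction k)
  case (Suc k)
  then show ?case by (simp add: act_mult funpow_Suc_right del: funpow.simps)
qed (simp add: act_one)

text \<open>A \<open>k\<close>-th power has both Heisenberg coordinates multiplied by
  \<open>k\<close>, so all displacements are divisible by \<open>k\<close>.\<close>

lemma heis_pow_level:
  assumes "x \<in> carrierB" "act n x = heis u w c" "burau_form n w u = 0"
  shows "x [^]\<^bsub>braid_group n\<^esub> k \<in> level_braid n k"
proof -
  have "act n (x [^]\<^bsub>braid_group n\<^esub> k) v = v + fun_scale (int k)
      (fun_scale (burau_form n v u) w + fun_scale (burau_form n v w + c * burau_form n v u) u)" for v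
    using assms
    by (simp add: act_pow heis_funpow) (simp add: heis_def form_simps algebra_simps)
  then show ?thesis using assms(1) unfolding level_braid_iff by blast
qed

text \<open>The construction of \<open>K_heis_shift\<close> with exponent 1, carried out in the
  braid group: a conjugate of \<open>\<sigma> 2\<close> times the inverse of
  \<open>\<sigma> 2\<close>.\<close>

lemma exists_heis:
  "\<exists>x\<in>carrierB. act n x = heis (chain_vec 0) (fun_scale 2 (chain_vec 2)) 4"
proof
  let ?g = "\<sigma> (Suc 0) \<star> \<sigma> 0 \<star> \<sigma> 0 \<star> \<sigma> (Suc 0)"
  have car: "\<sigma> 0 \<in> carrierB" "\<sigma> (Suc 0) \<in> carrierB" "\<sigma> 2 \<in> carrierB" using n by auto
  then have g: "?g \<in> carrierB" by simp
  have act: "act n (\<sigma> 0) = transv (chain_vec 0) 1" "act n (\<sigma> (Suc 0)) = transv (chain_vec (Suc 0)) 1"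
    "act n (\<sigma> 2) = transv (chain_vec 2) 1"
    using n act_\<sigma> by auto
  have g_v2: "act n ?g (chain_vec 2) = chain_vec 2 + fun_scale 2 (chain_vec 0)"
    using car transv_square_shift by (simp add: act_mult act del: plus_fun_apply)
  have zero: "act n ?g 0 = 0" using act_linear(2)[of n ?g 0 0] by simp
  have "act n (conj ?g (\<sigma> 2)) = transv (chain_vec 2 + fun_scale 2 (chain_vec 0)) 1"
    using heis_conj[OF isometry_act[OF g] act_inv(1)[OF g], of "chain_vec 2" 0 1] g car
    by (simp only: act_conj act g_v2 zero)
  moreover have "act n (invB (\<sigma> 2)) = transv (chain_vec 2) (- 1)"
    using act_inv_heis[of "\<sigma> 2" "chain_vec 2" 0 1] car act by simp
  ultimately show "act n (conj ?g (\<sigma> 2) \<star> invB (\<sigma> 2)) = heis (chain_vec 0) (fun_scale 2 (chain_vec 2)) 4"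
    using transv_comp_shift[of "chain_vec 2" "chain_vec 0" 2 1] form_small g car
    by (simp add: act_mult del: plus_fun_apply)
  show "conj ?g (\<sigma> 2) \<star> invB (\<sigma> 2) \<in> carrierB" using g car by simp
qed

text \<open>The exponent arising in \<open>core_transv\<close>: the directions there are
  \<open>2 * m\<close> times \<open>chain_vec 2\<close> and
  \<open>chain_vec 2 + chain_vec 3\<close>, and the commutator doubles their pairing.\<close>

definition q :: nat where "q = 8 * m * m"

text \<open>Conjugation by \<open>\<sigma> 3\<close> fixes \<open>chain_vec 0\<close> and yields a
  second direction not orthogonal to the first. The \<open>m\<close>-th powers lie in the level
  group, so their commutator is in the core.\<close>

lemma core_transv: "\<exists>x\<in>core. act n x = transv (chain_vec 0) (int q)"
proof -
  let ?e = "chain_vec 0" and ?w2 = "fun_scale 2 (chain_vec 2)"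
  let ?w1 = "fun_scale 2 (chain_vec 2 + chain_vec 3)"
  obtain x2 where x2: "x2 \<in> carrierB" "act n x2 = heis ?e ?w2 4" using exists_heis by blast
  have s3: "\<sigma> 3 \<in> carrierB" "act n (\<sigma> 3) = transv (chain_vec 3) 1" using n by (auto simp: act_\<sigma>)
  have "act n (\<sigma> 3) ?e = ?e" "act n (\<sigma> 3) ?w2 = ?w1"
    using form_small by (simp_all add: s3 heis_def form_simps scale_right_distrib del: plus_fun_apply)
  then have x1: "act n (conj (\<sigma> 3) x2) = heis ?e ?w1 4" "conj (\<sigma> 3) x2 \<in> carrierB"
    using heis_conj[OF isometry_act[OF s3(1)] act_inv(1)[OF s3(1)]] x2 s3(1) by (simp_all add: act_conj)
  have perp: "burau_form n ?w1 ?e = 0" "burau_form n ?w2 ?e = 0"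
    using form_small by (simp_all add: form_simps)
  define a where "a = conj (\<sigma> 3) x2 [^]\<^bsub>braid_group n\<^esub> m"
  define b where "b = x2 [^]\<^bsub>braid_group n\<^esub> m"
  have level: "a \<in> level_braid n m" "b \<in> level_braid n m"
    using heis_pow_level x1 x2 perp by (auto simp: a_def b_def)
  have act: "act n a = heis ?e (fun_scale (int m) ?w1) (int m * 4)"
    "act n b = heis ?e (fun_scale (int m) ?w2) (int m * 4)"
    using x1 x2 perp by (simp_all add: a_def b_def act_pow heis_funpow)
  have act': "act n (invB a) = heis ?e (- fun_scale (int m) ?w1) (- (int m * 4))"
    "act n (invB b) = heis ?e (- fun_scale (int m) ?w2) (- (int m * 4))"
    using act level perp by (auto intro!: act_inv_heis level_carrier simp: form_simps)
  have "act n (a \<star> b \<star> invB a \<star> invB b) = act n a \<circ> act n b \<circ> act n (invB a) \<circ> act n (invB b)"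
    using level level_carrier by (simp add: act_mult)
  also have "\<dots> = transv ?e (int q)"
    unfolding act act'
    by (subst heis_commutator) (use perp form_small in \<open>simp_all add: form_simps q_def mult.assoc\<close>)
  finally show ?thesis using core_commutator[OF level] by blast
qed

sublocale normalized_chain fun_scale "burau_form n" chain_vec "n - Suc 0" "act n ` core" "int q"
proof
  have "\<one>\<^bsub>braid_group n\<^esub> \<in> core"
    using core_transv core_mult core_inv B.r_inv core_level level_carrier by metis
  then show "id \<in> act n ` core" by (rule image_eqI[rotated]) (simp add: act_one)
  show "0 < int q" using m by (simp add: q_def)
  show "transv (chain_vec 0) (int q) \<in> act n ` core" using core_transv by (metis image_eqI)
  fix k assume "k \<in> act n ` core"
  then obtain x where x: "x \<in> core" "k = act n x" by blast
  note car = level_carrier[OF core_level]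
  show "\<exists>k'\<in>act n ` core. k' \<circ> k = id"
    using x act_inv(2)[OF car[OF x(1)]] core_inv[OF x(1)] by blast
  show "transv (chain_vec i) 1 \<circ> k \<circ> transv (chain_vec i) (- 1) \<in> act n ` core" if "i < n - Suc 0" for i
  proof -
    have i: "Suc i < n" using that by simp
    have "act n (conj (\<sigma> i) x) = transv (chain_vec i) 1 \<circ> k \<circ> transv (chain_vec i) (- 1)"
      using i x car act_letter_transv[OF i, of True] act_letter_transv[OF i, of False]
      by (simp add: act_conj letter_False)
    then show ?thesis using core_conj[OF x(1), of "\<sigma> i"] i by (metis \<sigma>_carrier image_eqI)
  qed
  fix k' assume "k' \<in> act n ` core"
  then obtain y where y: "y \<in> core" "k' = act n y" by blast
  then have "k \<circ> k' = act n (x \<star> y)" using x car by (simp add: act_mult)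
  then show "k \<circ> k' \<in> act n ` core" using core_mult[OF x(1) y(1)] by (rule image_eqI)
qed

section \<open>Conjugation invariance on a deeper level subgroup\<close>

definition deep :: nat where "deep = nat (level * level)"

text \<open>The square of \<open>level\<close> is the divisibility that \<open>moves_to_v0\<close>
  asks for; the factor \<open>m\<close> comes from \<open>q\<close>.\<close>

lemma deep: "int deep = level * level" "deep \<ge> 1" "m dvd deep"
proof -
  show eq: "int deep = level * level" by (simp add: deep_def)
  have "0 < level" using q_pos by (simp add: level_def)
  then have "0 < level * level" by simp
  then show "deep \<ge> 1" unfolding eq[symmetric] by simp
  have "int m dvd int deep" unfolding eq level_def unfolding q_def by simp
  then show "m dvd deep" by simp
qed

lemma deep_level: "x \<in> level_braid n deep \<Longrightarrow> x \<in> level_braid n m"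
proof -
  assume x: "x \<in> level_braid n deep"
  obtain k where k: "deep = m * k" using deep(3) by blast
  have "\<exists>w. act n x v = v + fun_scale (int m) w" for v
  proof -
    obtain w where "act n x v = v + fun_scale (int deep) w" using x by (auto simp: level_braid_iff)
    then have "act n x v = v + fun_scale (int m) (fun_scale (int k) w)" by (simp add: k)
    then show ?thesis by blast
  qed
  with x show ?thesis by (simp add: level_braid_iff)
qed

text \<open>The isometry \<open>x\<close> keeps the pairing 1 of the first two chain vectors, so
  \<open>moves_to_v0\<close> gives \<open>k\<close> in the core with \<open>k \<star> x\<close>
  fixing \<open>chain_vec 0\<close>. Then \<open>k \<star> x\<close> commutes with
  \<open>\<sigma> 0\<close> up to the Torelli group, and \<open>f\<close> does not see
  \<open>k\<close>, nor its conjugates.\<close>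

lemma f_conj_\<sigma>_0:
  assumes x: "x \<in> level_braid n deep"
  shows "f (conj (\<sigma> 0) x) = f x"
proof -
  let ?v = "chain_vec 0" and ?s = "\<sigma> 0"
  note car = level_carrier[OF x]
  have s: "?s \<in> carrierB" "act n ?s = transv ?v 1" using n act_\<sigma>[of 0] by auto
  have L: "chain_vec 0 \<in> L" "chain_vec (Suc 0) \<in> L" using n by (auto intro: v_in_L)
  obtain z where "z \<in> L" "act n x ?v - ?v = fun_scale (level * level) z"
    using level_L[OF x deep(2) L(1)] deep(1) by auto
  moreover have "burau_form n (act n x ?v) (act n x (chain_vec (Suc 0))) = 1"
    using isometryD(3)[OF isometry_act[OF car]] form_small by simp
  ultimately have "moves (act n x ?v) ?v" using moves_to_v0 act_L[OF car L(2)] by blast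
  then obtain k where k: "k \<in> core" "act n k (act n x ?v) = ?v" by (auto simp: moves_def)
  note kcar = level_carrier[OF core_level[OF k(1)]]
  have xm: "x \<in> level_braid n m" using x by (rule deep_level)
  have kx: "k \<star> x \<in> level_braid n m" "k \<star> x \<in> carrierB"
    using subgroup.m_closed[OF subgroup_level_braid core_level[OF k(1)] xm] level_carrier by auto
  let ?a = "act n (k \<star> x)"
  have fix_v: "?a ?v = ?v" "?a 0 = 0"
    using k kcar car act_linear(2)[of n "k \<star> x" 0 0] by (simp_all add: act_mult)
  have "?a \<circ> act n ?s \<circ> act n (invB (k \<star> x)) = act n ?s"
    using heis_conj[OF isometry_act[OF kx(2)] act_inv(1)[OF kx(2)], of ?v 0 1]
    by (simp only: s fix_v)
  then have comm: "?a \<circ> act n ?s = act n ?s \<circ> ?a"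
    using comp_assoc[of "?a \<circ> act n ?s" "act n (invB (k \<star> x))" ?a]
    by (simp only: act_inv(2)[OF kx(2)] comp_id)
  have "act n (conj ?s (k \<star> x)) = ?a \<circ> act n ?s \<circ> act n (invB ?s)"
    by (simp only: act_conj[OF s(1) kx(2)] comm)
  also have "\<dots> = ?a" by (simp only: comp_assoc act_inv(1)[OF s(1)] comp_id)
  finally have "act n (conj ?s (k \<star> x)) = ?a" .
  then have "f (conj ?s (k \<star> x)) = f (k \<star> x)"
    using f_act_eq level_conj[OF s(1) kx(1)] kx(1) by blast
  moreover have "f (k \<star> x) = f x" using f_mult core_level[OF k(1)] xm core_f[OF k(1)] by simp
  moreover have "f (conj ?s (k \<star> x)) = f (conj ?s x)"
    using f_conj_mult[OF s(1) core_level[OF k(1)] xm] core_f[OF core_conj[OF k(1) s(1)]] by simp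
  ultimately show ?thesis by simp
qed

lemma f_\<sigma>_pow: "f (\<sigma> 0 [^]\<^bsub>braid_group n\<^esub> q) = 0"
proof -
  obtain x where x: "x \<in> core" "act n x = transv (chain_vec 0) (int q)" using core_transv by blast
  have s: "\<sigma> 0 \<in> carrierB" "act n (\<sigma> 0) = transv (chain_vec 0) 1" using n act_\<sigma>[of 0] by auto
  have act: "act n (\<sigma> 0 [^]\<^bsub>braid_group n\<^esub> q) = act n x"
    using s x by (simp add: act_pow heis_funpow)
  have "act n (\<sigma> 0 [^]\<^bsub>braid_group n\<^esub> q) v = act n x v" for v using act by simp
  then have "\<sigma> 0 [^]\<^bsub>braid_group n\<^esub> q \<in> level_braid n m"
    using core_level[OF x(1)] s(1) by (simp add: level_braid_iff)
  then show ?thesis using f_act_eq[OF _ core_level[OF x(1)] act] core_f[OF x(1)] by simp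
qed

text \<open>Twisting \<open>f\<close> by a conjugation transports the result for
  \<open>\<sigma> 0\<close> to its conjugates, with the same \<open>deep\<close>.\<close>

lemma level_hom_conj:
  assumes "h \<in> carrierB"
  shows "level_hom n m (\<lambda>x. f (conj h x))"
proof
  show "f (conj h (x \<star> y)) = f (conj h x) + f (conj h y)"
    if "x \<in> level_braid n m" "y \<in> level_braid n m" for x y
    using f_conj_mult assms that .
  fix x assume x: "x \<in> braid_torelli n"
  then have "conj h x \<in> braid_torelli n"
    using assms act_inv(1)[OF assms] by (simp add: braid_torelli_iff act_conj)
  then show "f (conj h x) = 0" by (rule f_torelli)
qed (rule n m)+

lemma f_conj_\<sigma>:
  assumes x: "x \<in> level_braid n deep" and i: "Suc i < n"
  shows "f (conj (\<sigma> i) x) = f x"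
proof -
  obtain h where h: "h \<in> carrierB" "\<sigma> i = conj h (\<sigma> 0)" using letter_conjugate[OF i] by blast
  have s: "\<sigma> 0 \<in> carrierB" using n by simp
  note car = level_carrier[OF x]
  have "conj (invB h) x \<in> level_braid n deep" using h(1) x by (intro level_conj) auto
  then have "f (conj h (conj (\<sigma> 0) (conj (invB h) x))) = f (conj h (conj (invB h) x))"
    by (rule level_hom.f_conj_\<sigma>_0[OF level_hom_conj[OF h(1)]])
  moreover have "conj h (conj (invB h) x) = x"
    using h(1) car by (rule conj_cancel)
  moreover have "conj h (conj (\<sigma> 0) (conj (invB h) x)) = conj (\<sigma> i) x"
  proof -
    have "h \<star> (\<sigma> 0 \<star> invB h) = \<sigma> i" using h s by (simp add: B.m_assoc)
    then show ?thesis
      using h(1) s car by (simp only: conj_conj[OF s] conj_conj[OF h(1)] B.inv_closed B.m_closed)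
  qed
  ultimately show ?thesis by simp
qed

lemma f_conj:
  assumes "g \<in> carrierB" "x \<in> level_braid n deep"
  shows "f (conj g x) = f x"
  using assms
proof (induction arbitrary: x rule: braid_group_induct)
  case one
  then show ?case using level_carrier by simp
next
  case (letter i b y)
  note s = \<sigma>_carrier[OF letter(1)]
  have inv: "f (conj (invB (\<sigma> i)) z) = f z" if z: "z \<in> level_braid n deep" for z
  proof -
    have "conj (invB (\<sigma> i)) z \<in> level_braid n deep" using s z by (intro level_conj) auto
    from f_conj_\<sigma>[OF this letter(1)] show ?thesis
      by (simp only: conj_cancel[OF s level_carrier[OF z]])
  qed
  have yx: "conj y x \<in> level_braid n deep" using letter by (simp add: level_conj)
  have "conj (letter n (i, b) \<star> y) x = conj (letter n (i, b)) (conj y x)"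
    using letter level_carrier by (simp add: conj_conj letter_carrier)
  also have "f \<dots> = f (conj y x)"
    using f_conj_\<sigma>[OF yx letter(1)] inv[OF yx] letter_False[OF letter(1)] by (cases b) simp_all
  finally show ?case using letter by simp
qed

lemma f_deep:
  assumes x: "x \<in> level_braid n deep"
  shows "f x = 0"
proof -
  let ?c = "level_label n deep"
  let ?N = "card (?c ` carrierB)"
  obtain F where F: "\<And>x y. x \<in> carrierB \<Longrightarrow> y \<in> carrierB \<Longrightarrow> F (x \<star> y) = F x + F y"
    "\<And>x. x \<in> level_braid n deep \<Longrightarrow> F x = of_nat ?N * f x"
  proof -
    have "\<exists>F. (\<forall>x\<in>carrierB. \<forall>y\<in>carrierB. F (x \<star> y) = F x + F y) \<and>
        (\<forall>x\<in>level_braid n deep. F x = of_nat ?N * f x)"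
      by (rule B.transfer_invariant_hom[OF subgroup_level_braid])
        (simp_all add: finite_level_label[OF deep(2)] level_label_eq_iff f_mult deep_level level_conj f_conj)
    then show ?thesis using that by blast
  qed
  have F_one: "F \<one>\<^bsub>braid_group n\<^esub> = 0"
    using F(1)[of "\<one>\<^bsub>braid_group n\<^esub>" "\<one>\<^bsub>braid_group n\<^esub>"] by simp
  have F_inv: "F (invB y) = - F y" if "y \<in> carrierB" for y
    using F(1)[of y "invB y"] that F_one by simp
  have F_pow: "F (y [^]\<^bsub>braid_group n\<^esub> (k::nat)) = of_nat k * F y" if "y \<in> carrierB" for y k
    using that by (induction k) (simp_all add: F_one F(1) algebra_simps)
  have s: "\<sigma> 0 \<in> carrierB" "act n (\<sigma> 0) = transv (chain_vec 0) 1" using n act_\<sigma>[of 0] by auto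
  \<comment> \<open>The power of \<open>\<sigma> 0\<close> with exponent \<open>deep * q\<close> is
    read in two ways: it has level \<open>deep\<close>, where \<open>F\<close> is a multiple of
    \<open>f\<close>, and it is a power of the \<open>q\<close>-th power, which \<open>f\<close>
    kills.\<close>
  have "F (\<sigma> 0) = 0"
  proof -
    have "\<sigma> 0 [^]\<^bsub>braid_group n\<^esub> deep \<in> level_braid n deep"
      using heis_pow_level[OF s] by simp
    then have lev: "(\<sigma> 0 [^]\<^bsub>braid_group n\<^esub> deep) [^]\<^bsub>braid_group n\<^esub> q \<in> level_braid n deep"
      by (rule subgroup_nat_pow[OF subgroup_level_braid])
    have "f ((\<sigma> 0 [^]\<^bsub>braid_group n\<^esub> q) [^]\<^bsub>braid_group n\<^esub> deep) = 0"
    proof -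
      have "\<sigma> 0 [^]\<^bsub>braid_group n\<^esub> m \<in> level_braid n m"
        using heis_pow_level[OF s] by simp
      then have "(\<sigma> 0 [^]\<^bsub>braid_group n\<^esub> m) [^]\<^bsub>braid_group n\<^esub> (8 * m) \<in> level_braid n m"
        by (rule subgroup_nat_pow[OF subgroup_level_braid])
      then have "\<sigma> 0 [^]\<^bsub>braid_group n\<^esub> q \<in> level_braid n m"
        using s(1) by (simp add: B.nat_pow_pow q_def mult.commute mult.left_commute)
      then show ?thesis by (simp add: f_pow f_\<sigma>_pow)
    qed
    then have "F ((\<sigma> 0 [^]\<^bsub>braid_group n\<^esub> deep) [^]\<^bsub>braid_group n\<^esub> q) = 0"
      using F(2)[OF lev] s(1) by (simp add: B.nat_pow_pow mult.commute)
    then show ?thesis using s(1) deep(2) m by (simp add: F_pow q_def)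
  qed
  have F_\<sigma>: "F (\<sigma> i) = 0" if i: "Suc i < n" for i
  proof -
    obtain h where "h \<in> carrierB" "\<sigma> i = conj h (\<sigma> 0)" using letter_conjugate[OF i] by blast
    then show ?thesis using s(1) \<open>F (\<sigma> 0) = 0\<close> by (simp add: F(1) F_inv)
  qed
  have "F y = 0" if "y \<in> carrierB" for y
    using that
  proof (induction rule: braid_group_induct)
    case (letter i b y)
    have "F (letter n (i, b)) = 0"
      using F_\<sigma>[OF letter(1)] F_inv[of "\<sigma> i"] letter(1) by (cases b) (simp_all add: letter_False)
    then show ?case using letter by (simp add: F(1) letter_carrier)
  qed (rule F_one)
  then have "of_nat ?N * f x = 0" using F(2)[OF x] level_carrier[OF x] by simp
  moreover have "?N \<noteq> 0"
    using finite_level_label[OF deep(2), of n] level_carrier[OF x] by auto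
  ultimately show ?thesis by simp
qed

text \<open>By pigeonhole two powers of \<open>x\<close> share a label, so a positive power has
  level \<open>deep\<close>; the rationals are torsion-free.\<close>

theorem f_zero:
  assumes x: "x \<in> level_braid n m"
  shows "f x = 0"
proof -
  note car = level_carrier[OF x]
  let ?p = "\<lambda>k::nat. x [^]\<^bsub>braid_group n\<^esub> k"
  have "finite (range (\<lambda>k. level_label n deep (?p k)))"
    using finite_level_label[OF deep(2), of n] car by (rule_tac finite_subset) auto
  then have "\<not> inj (\<lambda>k. level_label n deep (?p k))"
    using finite_imageD by blast
  then obtain i j where ij: "i < j" "level_label n deep (?p i) = level_label n deep (?p j)"
    by (metis (mono_tags, lifting) injI linorder_neqE_nat)
  have "?p j = ?p i \<star> ?p (j - i)" using ij car by (simp add: B.nat_pow_mult)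
  then have "invB (?p i) \<star> ?p j = ?p (j - i)" using car by (simp add: B.inv_solve_left')
  then have "?p (j - i) \<in> level_braid n deep"
    using level_label_eq_iff[of "?p i" n "?p j" deep] ij car by simp
  then have "of_nat (j - i) * f x = 0" using f_deep f_pow[OF x, of "j - i"] by metis
  then show ?thesis using ij by simp
qed

end

section \<open>First homology\<close>

text \<open>A basis of \<open>W\<close> stays independent after adding \<open>c\<close>, so the
  values 0 and 1 can be prescribed and extended linearly.\<close>

lemma separating_functional:
  fixes W :: "('a \<Rightarrow>\<^sub>0 rat) set"
  assumes W: "0 \<in> W" "\<And>x y. x \<in> W \<Longrightarrow> y \<in> W \<Longrightarrow> x + y \<in> W"
      "\<And>q x. x \<in> W \<Longrightarrow> Poly_Mapping.map ((*) q) x \<in> W"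
    and c: "c \<notin> W"
  shows "\<exists>\<phi> :: ('a \<Rightarrow>\<^sub>0 rat) \<Rightarrow> rat. (\<forall>x y. \<phi> (x + y) = \<phi> x + \<phi> y) \<and> (\<forall>x\<in>W. \<phi> x = 0) \<and> \<phi> c = 1"
proof -
  let ?s = "\<lambda>q (x :: 'a \<Rightarrow>\<^sub>0 rat). Poly_Mapping.map ((*) q) x"
  interpret vector_space_pair ?s "(*) :: rat \<Rightarrow> rat \<Rightarrow> rat"
    by unfold_locales
      (auto simp: algebra_simps lookup_add intro!: poly_mapping_eqI)
  have subspace: "vs1.subspace W" using W by (intro vs1.subspaceI) auto
  obtain B where B: "B \<subseteq> W" "vs1.independent B" "W \<subseteq> vs1.span B"
    by (rule vs1.maximal_independent_subset)
  then have "c \<notin> vs1.span B" using vs1.span_minimal[OF B(1) subspace] c by blast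
  with B have "vs1.independent (insert c B)" by (simp add: vs1.independent_insertI)
  then obtain \<phi> where \<phi>: "Vector_Spaces.linear ?s (*) \<phi>" "\<forall>x\<in>insert c B. \<phi> x = (if x = c then 1 else 0)"
    using linear_independent_extend[of "insert c B" "\<lambda>x. if x = c then 1 else 0"] by blast
  interpret l: Vector_Spaces.linear ?s "(*) :: rat \<Rightarrow> rat \<Rightarrow> rat" \<phi> by (rule \<phi>(1))
  have "\<phi> x = 0" if "x \<in> W" for x
    using vs1.span_base l.eq_0_on_span[of B x] \<phi>(2) B that c by (metis insertCI subsetD)
  then show ?thesis using l.add \<phi>(2) by (intro exI[of _ \<phi>]) auto
qed

section \<open>Rational chains and homology under inclusion\<close>

lemma boundary2_restrict [simp]: "boundary2 (G\<lparr>carrier := A\<rparr>) c = boundary2 G c"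
  by (simp add: boundary2_def)

lemma boundaries1_mono: "A \<subseteq> B \<Longrightarrow> boundaries1 (G\<lparr>carrier := A\<rparr>) \<subseteq> boundaries1 (G\<lparr>carrier := B\<rparr>)"
  unfolding boundaries1_def boundary2_restrict by (rule image_mono) (auto simp: chains2_def)

lemma chains1_mono: "A \<subseteq> B \<Longrightarrow> chains1 (G\<lparr>carrier := A\<rparr>) \<subseteq> chains1 (G\<lparr>carrier := B\<rparr>)"
  by (auto simp: chains1_def)

lemma boundary_pair:
  assumes "x \<in> carrier G" "y \<in> carrier G"
  shows "Poly_Mapping.single y 1 - Poly_Mapping.single (x \<otimes>\<^bsub>G\<^esub> y) 1 + Poly_Mapping.single x 1 \<in> boundaries1 G"
  unfolding boundaries1_def
  by (rule image_eqI[of _ _ "Poly_Mapping.single (x, y) 1"])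
    (use assms in \<open>simp_all add: boundary2_def chains2_def Let_def\<close>)

lemma chains1_subset:
  assumes "\<And>x. x \<in> carrier G \<Longrightarrow> Poly_Mapping.single x 1 \<in> W"
    and W: "0 \<in> W" "\<And>x y. x \<in> W \<Longrightarrow> y \<in> W \<Longrightarrow> x + y \<in> W"
      "\<And>q x. x \<in> W \<Longrightarrow> Poly_Mapping.map ((*) q) x \<in> W"
  shows "chains1 G \<subseteq> W"
proof
  fix c assume c: "c \<in> chains1 G"
  have "(\<Sum>k\<in>K. Poly_Mapping.single k (Poly_Mapping.lookup c k)) \<in> W"
    if "finite K" "K \<subseteq> carrier G" for K
    using that
  proof (induction K rule: finite_induct)
    case (insert k K)
    have "Poly_Mapping.single k (Poly_Mapping.lookup c k) \<in> W"
      using W(3)[OF assms(1), of k "Poly_Mapping.lookup c k"] insert.prems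
      by (simp add: map_mult_single)
    with insert W show ?case by simp
  qed (use W in simp)
  from this[of "Poly_Mapping.keys c"] c show "c \<in> W"
    by (simp add: chains1_def poly_mapping_sum_single_lookup)
qed

text \<open>A cycle of the larger group that is not homologous to one of the smaller group would be
  detected by a rational homomorphism vanishing on the smaller group.\<close>

lemma chains1_decompose:
  assumes AB: "A \<subseteq> B"
    and hom: "\<And>f x. \<lbrakk>\<And>x y. x \<in> B \<Longrightarrow> y \<in> B \<Longrightarrow> f (x \<otimes>\<^bsub>G\<^esub> y) = f x + f y; \<And>x. x \<in> A \<Longrightarrow> f x = 0; x \<in> B\<rbrakk>
      \<Longrightarrow> f x = (0 :: rat)"
    and c: "c \<in> chains1 (G\<lparr>carrier := B\<rparr>)"
  shows "\<exists>a\<in>chains1 (G\<lparr>carrier := A\<rparr>). c - a \<in> boundaries1 (G\<lparr>carrier := B\<rparr>)"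
proof -
  let ?A = "G\<lparr>carrier := A\<rparr>" and ?B = "G\<lparr>carrier := B\<rparr>"
  define W where "W = {c. \<exists>a\<in>chains1 ?A. c - a \<in> boundaries1 ?B}"
  have W: "0 \<in> W" "\<And>x y. x \<in> W \<Longrightarrow> y \<in> W \<Longrightarrow> x + y \<in> W"
    "\<And>q x. x \<in> W \<Longrightarrow> Poly_Mapping.map ((*) q) x \<in> W"
  proof -
    show "0 \<in> W" using chains1_closed(1)[of ?A] boundaries1_closed(1)[of ?B] by (force simp: W_def)
    fix x assume "x \<in> W"
    then obtain a where a: "a \<in> chains1 ?A" "x - a \<in> boundaries1 ?B" by (auto simp: W_def)
    show "Poly_Mapping.map ((*) q) x \<in> W" for q
      using chains1_closed(3)[OF a(1)] boundaries1_closed(3)[OF a(2)]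
      by (auto simp: W_def map_mult_diff)
    fix y assume "y \<in> W"
    then obtain b where b: "b \<in> chains1 ?A" "y - b \<in> boundaries1 ?B" by (auto simp: W_def)
    have "x + y - (a + b) \<in> boundaries1 ?B"
      using boundaries1_closed(2)[OF a(2) b(2)] by (simp only: add_diff_add)
    then show "x + y \<in> W" using chains1_closed(2)[OF a(1) b(1)] by (auto simp: W_def)
  qed
  have W_boundary: "b \<in> W" if "b \<in> boundaries1 ?B" for b
    using that chains1_closed(1)[of ?A] by (force simp: W_def)
  have W_A: "a \<in> W" if "a \<in> chains1 ?A" for a
    using that boundaries1_closed(1)[of ?B] by (force simp: W_def)
  have "Poly_Mapping.single x 1 \<in> W" if x: "x \<in> B" for x
  proof (rule ccontr)
    assume "Poly_Mapping.single x 1 \<notin> W"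
    from separating_functional[OF W this] obtain \<phi> :: "('a \<Rightarrow>\<^sub>0 rat) \<Rightarrow> rat"
      where \<phi>: "\<And>x y. \<phi> (x + y) = \<phi> x + \<phi> y" "\<And>x. x \<in> W \<Longrightarrow> \<phi> x = 0"
        "\<phi> (Poly_Mapping.single x 1) = 1"
      by blast
    \<comment> \<open>The functional kills boundaries, which is exactly additivity of
      \<open>f\<close> on products.\<close>
    define f where "f y = \<phi> (Poly_Mapping.single y 1)" for y
    have diff: "\<phi> (x - y) = \<phi> x - \<phi> y" for x y
      using \<phi>(1)[of "x - y" y] by simp
    have "f x = 0"
    proof (rule hom[OF _ _ x])
      fix y z assume "y \<in> B" "z \<in> B"
      then have "\<phi> (Poly_Mapping.single z 1 - Poly_Mapping.single (y \<otimes>\<^bsub>G\<^esub> z) 1 + Poly_Mapping.single y 1) = 0"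
        using boundary_pair[of y ?B z] by (intro \<phi>(2) W_boundary) simp
      then show "f (y \<otimes>\<^bsub>G\<^esub> z) = f y + f z" by (simp add: f_def \<phi>(1) diff)
    next
      fix y assume "y \<in> A"
      then show "f y = 0" unfolding f_def by (intro \<phi>(2) W_A) (simp add: chains1_def)
    qed
    with \<phi>(3) show False by (simp add: f_def)
  qed
  then have "chains1 ?B \<subseteq> W" using W by (intro chains1_subset) auto
  with c show ?thesis by (auto simp: W_def)
qed

text \<open>Inclusion induces a linear map on homology, onto by \<open>chains1_decompose\<close>;
  \<open>fd\<close> makes rank-nullity available.\<close>

lemma H1_dim_le:
  assumes AB: "A \<subseteq> B"
    and hom: "\<And>f x. \<lbrakk>\<And>x y. x \<in> B \<Longrightarrow> y \<in> B \<Longrightarrow> f (x \<otimes>\<^bsub>G\<^esub> y) = f x + f y; \<And>x. x \<in> A \<Longrightarrow> f x = 0; x \<in> B\<rbrakk>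
      \<Longrightarrow> f x = (0 :: rat)"
    and fd: "H1_fin_dim (G\<lparr>carrier := A\<rparr>)"
  shows "H1_dim (G\<lparr>carrier := B\<rparr>) \<le> H1_dim (G\<lparr>carrier := A\<rparr>)"
proof -
  let ?A = "G\<lparr>carrier := A\<rparr>" and ?B = "G\<lparr>carrier := B\<rparr>"
  \<comment> \<open>Any representative may be chosen, since boundaries of the smaller group remain
    boundaries in the larger one.\<close>
  define T where "T C = H1_class ?B (SOME c. c \<in> chains1 ?A \<and> C = H1_class ?A c)" for C
  have T: "T (H1_class ?A c) = H1_class ?B c" if "c \<in> chains1 ?A" for c
  proof -
    let ?d = "SOME d. d \<in> chains1 ?A \<and> H1_class ?A c = H1_class ?A d"
    have "?d \<in> chains1 ?A \<and> H1_class ?A c = H1_class ?A ?d"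
      by (rule someI[of _ c]) (use that in simp)
    then have "c - ?d \<in> boundaries1 ?B"
      using boundaries1_mono[OF AB] by (auto simp: H1_class_eq_iff)
    then show ?thesis by (simp add: T_def flip: H1_class_eq_iff)
  qed
  have carA: "carrier (H1 ?A) = H1_class ?A ` chains1 ?A" and carB: "carrier (H1 ?B) = H1_class ?B ` chains1 ?B"
    by (simp_all add: H1_def)
  note sub = chains1_mono[OF AB, of G]
  have "T \<in> module_hom class_ring (H1 ?A) (H1 ?B)"
    using sub by (auto simp: module_hom_def carA carB H1_add H1_smult T chains1_closed)
  then interpret linear_map "class_ring :: rat ring" "H1 ?A" "H1 ?B" T
    by (simp add: linear_map_def mod_hom_def mod_hom_axioms_def vectorspace_H1 vectorspace.axioms(1))
  have surj: "T ` carrier (H1 ?A) = carrier (H1 ?B)"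
  proof
    show "carrier (H1 ?B) \<subseteq> T ` carrier (H1 ?A)"
    proof
      fix C assume "C \<in> carrier (H1 ?B)"
      then obtain c where c: "c \<in> chains1 ?B" "C = H1_class ?B c" by (auto simp: carB)
      obtain a where a: "a \<in> chains1 ?A" "c - a \<in> boundaries1 ?B"
      proof -
        have "\<exists>a\<in>chains1 ?A. c - a \<in> boundaries1 ?B"
          by (rule chains1_decompose[OF AB _ c(1)]) (rule hom, blast+)
        then show ?thesis using that by blast
      qed
      then have "C = T (H1_class ?A a)" by (simp add: T c(2) H1_class_eq_iff)
      with a show "C \<in> T ` carrier (H1 ?A)" by (auto simp: carA)
    qed
  qed (use sub in \<open>auto simp: carA carB T\<close>)
  have "W.dim + vectorspace.dim class_ring (V.vs kerT) = V.dim"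
    using rank_nullity[OF fd] surj by (simp add: im_def)
  then show ?thesis by simp
qed

text \<open>Modulo boundaries a product becomes a sum, so the classes of a finite generating set
  span.\<close>

lemma finitely_generated_imp_H1_fin_dim:
  fixes G (structure)
  assumes G: "group G" and fg: "finitely_generated G"
  shows "H1_fin_dim G"
proof -
  interpret group G by (rule G)
  interpret V: vectorspace "class_ring :: rat ring" "H1 G" by (rule vectorspace_H1)
  obtain S where S: "finite S" "S \<subseteq> carrier G" "generate G S = carrier G"
    using fg by (auto simp: finitely_generated_def)
  let ?g = "\<lambda>x. H1_class G (Poly_Mapping.single x 1)"
  have carV: "carrier (H1 G) = H1_class G ` chains1 G" by (simp add: H1_def)
  have gS: "?g ` S \<subseteq> carrier (H1 G)" using S by (auto simp: carV chains1_def)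
  interpret sub: submodule "class_ring :: rat ring" "V.span (?g ` S)" "H1 G"
    by (rule V.span_is_submodule[OF gS])
  define W where "W = {c \<in> chains1 G. H1_class G c \<in> V.span (?g ` S)}"
  have W: "0 \<in> W" "\<And>x y. x \<in> W \<Longrightarrow> y \<in> W \<Longrightarrow> x + y \<in> W"
    "\<And>q x. x \<in> W \<Longrightarrow> Poly_Mapping.map ((*) q) x \<in> W"
  proof -
    show "0 \<in> W" using sub.zero_closed chains1_closed(1) by (auto simp: W_def H1_def)
    fix x assume x: "x \<in> W"
    then show "Poly_Mapping.map ((*) q) x \<in> W" for q
      using sub.smult_closed[of q "H1_class G x"] chains1_closed(3) by (auto simp: W_def H1_smult)
    fix y assume y: "y \<in> W"
    then show "x + y \<in> W"
      using x sub.m_closed[of "H1_class G x" "H1_class G y"] chains1_closed(2) by (auto simp: W_def H1_add)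
  qed
  have W_neg: "- x \<in> W" if "x \<in> W" for x
  proof -
    have "Poly_Mapping.map ((*) (-1)) x = - x" by (rule poly_mapping_eqI) simp
    then show ?thesis using W(3)[OF that, of "-1"] by simp
  qed
  have W_cong: "d \<in> W" if "c \<in> W" "d - c \<in> boundaries1 G" for c d
  proof -
    have "d - c + c \<in> chains1 G"
      using that boundaries1_subset_chains1[OF G] by (intro chains1_closed) (auto simp: W_def)
    moreover have "H1_class G d = H1_class G c" using that(2) by (simp add: H1_class_eq_iff)
    ultimately show ?thesis using that(1) by (simp add: W_def)
  qed
  let ?s = "\<lambda>x. Poly_Mapping.single x 1 :: 'a \<Rightarrow>\<^sub>0 rat"
  have mult: "?s x \<in> W \<Longrightarrow> ?s y \<in> W \<Longrightarrow> ?s (x \<otimes> y) \<in> W" if "x \<in> carrier G" "y \<in> carrier G" for x y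
    using boundaries1_closed(4)[OF boundary_pair[OF that]] W(2)[of "?s x" "?s y"]
    by (auto intro: W_cong[of "?s x + ?s y"] simp: algebra_simps)
  \<comment> \<open>The pair of identities has the chain of the identity as its boundary.\<close>
  have one: "?s \<one> \<in> W"
    using boundary_pair[of \<one> G \<one>] W(1) by (auto intro: W_cong[of 0])
  have base: "?s x \<in> W" if "x \<in> S" for x
    using that S V.in_own_span[OF gS] by (auto simp: W_def chains1_def)
  have inv: "?s (inv x) \<in> W" if "x \<in> S" for x
  proof (rule W_cong)
    show "?s \<one> + - ?s x \<in> W" using W(2)[OF one W_neg[OF base[OF that]]] .
    show "?s (inv x) - (?s \<one> + - ?s x) \<in> boundaries1 G"
      using boundary_pair[of x G "inv x"] that S by (auto simp: algebra_simps)
  qed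
  have "?s x \<in> W" if "x \<in> generate G S" for x
    using that
  proof (induction rule: generate.induct)
    case (eng x y)
    then show ?case using mult S generate_in_carrier by blast
  qed (use one base inv in auto)
  then have "chains1 G \<subseteq> W" using S W by (intro chains1_subset) auto
  then have "carrier (H1 G) \<subseteq> V.span (?g ` S)" by (auto simp: carV W_def)
  then have "V.gen_set (?g ` S)" using sub.subset by auto
  then show ?thesis using S gS unfolding V.fin_dim_def by blast
qed

lemma braid_group_trivial:
  assumes "n \<le> 1" "x \<in> carrier (braid_group n)"
  shows "x = \<one>\<^bsub>braid_group n\<^esub>"
  using assms(2) by (induction rule: braid_group_induct) (use assms(1) in auto)

text \<open>An odd \<open>n\<close> other than 3 is 1 or at least 5. For 1 the braid group is
  trivial, so every element is in the Torelli group.\<close>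

lemma level_hom_vanishes:
  fixes f :: "braid_word set \<Rightarrow> rat"
  assumes "odd n" "n \<noteq> 3" "1 \<le> m"
    and "\<And>x y. x \<in> level_braid n m \<Longrightarrow> y \<in> level_braid n m \<Longrightarrow>
      f (x \<otimes>\<^bsub>braid_group n\<^esub> y) = f x + f y"
    and "\<And>x. x \<in> braid_torelli n \<Longrightarrow> f x = 0"
    and x: "x \<in> level_braid n m"
  shows "f x = 0"
proof (cases "5 \<le> n")
  case True
  then interpret level_hom n m f by unfold_locales (use assms in auto)
  show ?thesis using x by (rule f_zero)
next
  case False
  have "n \<in> {0, 1, 2, 3, 4}" using False by auto
  with assms(1,2) have "n \<le> 1" by auto
  then have "x \<in> braid_torelli n"
    using braid_group_trivial[of n x] x by (simp add: level_braid_iff braid_torelli_iff act_one)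
  then show ?thesis by (rule assms)
qed

theorem proposition1p12:
  fixes n :: nat
  assumes "odd n"
    and "n \<noteq> 3"
    and "\<not> bdd_above ((\<lambda>m. H1_dim (level_braid_group n m)) ` {1..})"
  shows "\<not> H1_fin_dim (braid_torelli_group n) \<and> \<not> finitely_generated (braid_torelli_group n)"
proof -
  have "\<not> H1_fin_dim (braid_torelli_group n)"
  proof
    assume fin: "H1_fin_dim (braid_torelli_group n)"
    \<comment> \<open>The right-hand side does not depend on \<open>m\<close>, so it bounds the
      whole sequence.\<close>
    have "H1_dim (level_braid_group n m) \<le> H1_dim (braid_torelli_group n)" if "1 \<le> m" for m
      by (rule H1_dim_le[OF torelli_subset_level _ fin])
        (rule level_hom_vanishes[OF assms(1,2) that], blast+)
    then have "bdd_above ((\<lambda>m. H1_dim (level_braid_group n m)) ` {1..})"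
      by (intro bdd_aboveI2) auto
    with assms(3) show False by blast
  qed
  moreover have "group (braid_torelli_group n)"
    by (rule group.subgroup_imp_group[OF group_braid_group subgroup_braid_torelli])
  ultimately show ?thesis using finitely_generated_imp_H1_fin_dim by blast
qed

end
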